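(* Let $G$ be a smooth Lie group (modelled on a locally convex space) which has an exponential function. Let $\sigma\colon G\times M\to M$, $(g,x)\mapsto gx$ be a $C^1$-action on a $C^1$-manifold $M$ (modelled on some locally convex space), and let $x\in M$ be a point with stabilizer $G_x$ such that there is a smooth manifold structure on $G/G_x$ which turns the quotient map $q\colon G\to G/G_x$ into a smooth submersion. Let \[ \widetilde b\colon G/G_x\to M,\quad gG_x\mapsto gx \] be the $C^1$-map induced by the orbit map $b\colon G\to M$, $g\mapsto gx$. Then for each $g\in G$, the tangent map $T_{gG_x}\widetilde b\colon T_{gG_x}(G/G_x)\to T_{gx}M$ is injective.
   Context: Conventions: everything is over the real field; all topological spaces and topological vector spaces are Hausdorff; "smooth" means $C^\infty$. For open subsets of real locally convex spaces, $C^r$ with $r\in\mathbb N\cup\{\infty\}$ means: continuous, with iterated directional derivatives $d^{k}f(x;y_1,\ldots,y_k)$ existing for all $k\le r$ and continuous in $(x,y_1,\ldots,y_k)$. A $C^r$-manifold modelled on a locally convex space $E$ is a Hausdorff space with a maximal atlas of charts onto open subsets of $E$ with $C^r$ transition maps. A smooth Lie group is a group with a smooth manifold structure (modelled on a locally convex space) with smooth group operations; $L(G)=T_eG$. $G$ has an exponential function if for each $v\in L(G)$ there is a (necessarily unique) smooth homomorphism $\gamma_v\colon\mathbb R\to G$ with $\gamma_v'(0)=v$; then $\exp_G\colon L(G)\to G$ is defined by $\exp_G(v)=\gamma_v(1)$, and $\gamma_v(t)=\exp_G(tv)$. (No smoothness of $\exp_G$ is required.) A $C^1$-action is a group action $\sigma\colon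 G\times M\to M$ which is a $C^1$-map. $G_x=\{g\in G\colon gx=x\}$, and $G/G_x$ is the set of left cosets. A smooth map $f\colon M\to N$ between smooth manifolds modelled on $E$ and $F$ is a smooth submersion if for each $x\in M$ there are charts $\phi\colon U_\phi\to V_\phi\subseteq E$ around $x$ and $\psi\colon U_\psi\to V_\psi\subseteq F$ around $f(x)$ such that $f(U_\phi)\subseteq U_\psi$ and $\psi\circ f\circ\phi^{-1}=\pi|_{V_\phi}$ for a continuous linear map $\pi\colon E\to F$ having a continuous linear right inverse. *)

theory Defs
  imports "HOL-Analysis.Analysis" "HOL-Algebra.Group_Action" "HOL-Algebra.Left_Coset" "HOL-Library.Extended_Nat"
begin

text \<open>
  The last condition on \<open>V\<close> unfolds \<^const>\<open>convex\<close>, whose sort excludes it from the specification.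
\<close>

class locally_convex_space = real_vector + topological_ab_group_add + t2_space +
  assumes tendsto_scaleR_nhds:
      "((\<lambda>p. fst p *\<^sub>R snd p) \<longlongrightarrow> r *\<^sub>R x) (nhds (r::real) \<times>\<^sub>F nhds x)"
    and locally_convex_0:
      "open U \<Longrightarrow> 0 \<in> U \<Longrightarrow>
        \<exists>V. open V \<and> 0 \<in> V \<and> V \<subseteq> U \<and>
          (\<forall>x\<in>V. \<forall>y\<in>V. \<forall>u\<ge>0. \<forall>v\<ge>0. u + v = 1 \<longrightarrow> u *\<^sub>R x + v *\<^sub>R y \<in> V)"

lemma locally_convex_space_convex_nhd:
  fixes U :: "'a::locally_convex_space set"
  assumes "open U" "0 \<in> U"
  obtains V where "open V" "0 \<in> V" "V \<subseteq> U" "convex V"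
  using locally_convex_0[OF assms] unfolding convex_def by blast

instance real_normed_vector \<subseteq> locally_convex_space
proof
  fix r :: real and x :: 'a
  show "((\<lambda>p. fst p *\<^sub>R snd p) \<longlongrightarrow> r *\<^sub>R x) (nhds r \<times>\<^sub>F nhds x)"
    by (intro tendsto_scaleR filterlim_fst filterlim_snd)
next
  fix U :: "'a set" assume "open U" "0 \<in> U"
  then obtain e where e: "e > 0" "ball 0 e \<subseteq> U"
    using open_contains_ball by blast
  have "convex (ball (0::'a) e)" by (rule convex_ball)
  with e show "\<exists>V. open V \<and> 0 \<in> V \<and> V \<subseteq> U \<and>
      (\<forall>x\<in>V. \<forall>y\<in>V. \<forall>u\<ge>0. \<forall>v\<ge>0. u + v = 1 \<longrightarrow> u *\<^sub>R x + v *\<^sub>R y \<in> V)"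
    unfolding convex_def by (intro exI[of _ "ball 0 e"]) auto
qed

instance prod :: (topological_monoid_add, topological_monoid_add) topological_monoid_add
proof
  fix a b :: "'a \<times> 'b"
  have f: "((\<lambda>p. fst (fst p)) \<longlongrightarrow> fst a) (nhds a \<times>\<^sub>F nhds b)"
          "((\<lambda>p. fst (snd p)) \<longlongrightarrow> fst b) (nhds a \<times>\<^sub>F nhds b)"
          "((\<lambda>p. snd (fst p)) \<longlongrightarrow> snd a) (nhds a \<times>\<^sub>F nhds b)"
          "((\<lambda>p. snd (snd p)) \<longlongrightarrow> snd b) (nhds a \<times>\<^sub>F nhds b)"
    by (intro tendsto_fst tendsto_snd filterlim_fst filterlim_snd)+
  show "((\<lambda>x. fst x + snd x) \<longlongrightarrow> a + b) (nhds a \<times>\<^sub>F nhds b)"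
    unfolding plus_prod_def by (intro tendsto_Pair tendsto_add f)
qed

instance prod :: (topological_group_add, topological_group_add) topological_group_add
proof
  fix a :: "'a \<times> 'b"
  show "(uminus \<longlongrightarrow> - a) (nhds a)"
    unfolding uminus_prod_def
    by (intro tendsto_Pair tendsto_minus tendsto_fst tendsto_snd filterlim_ident)
qed

instance prod :: (topological_ab_group_add, topological_ab_group_add) topological_ab_group_add ..

instance prod :: (locally_convex_space, locally_convex_space) locally_convex_space
proof
  fix r :: real and x :: "'a \<times> 'b"
  let ?F = "nhds r \<times>\<^sub>F nhds x"
  have "filterlim (\<lambda>p. (fst p, fst (snd p))) (nhds r \<times>\<^sub>F nhds (fst x)) ?F"
       "filterlim (\<lambda>p. (fst p, snd (snd p))) (nhds r \<times>\<^sub>F nhds (snd x)) ?F"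
    by (intro filterlim_Pair tendsto_fst tendsto_snd filterlim_fst filterlim_snd)+
  note * = filterlim_compose[OF tendsto_scaleR_nhds this(1)]
           filterlim_compose[OF tendsto_scaleR_nhds this(2)]
  show "((\<lambda>p. fst p *\<^sub>R snd p) \<longlongrightarrow> r *\<^sub>R x) ?F"
    unfolding scaleR_prod_def by (intro tendsto_Pair) (use * in simp_all)
next
  fix U :: "('a \<times> 'b) set" assume "open U" "0 \<in> U"
  then obtain A B where AB: "open A" "open B" "0 \<in> A \<times> B" "A \<times> B \<subseteq> U"
    by (metis open_prod_elim)
  hence "0 \<in> A" "0 \<in> B" by (auto simp: zero_prod_def)
  obtain V where V: "open V" "0 \<in> V" "V \<subseteq> A" "convex V"
    using locally_convex_space_convex_nhd[OF AB(1) \<open>0 \<in> A\<close>] .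
  obtain W where W: "open W" "0 \<in> W" "W \<subseteq> B" "convex W"
    using locally_convex_space_convex_nhd[OF AB(2) \<open>0 \<in> B\<close>] .
  have "convex (V \<times> W)" by (intro convex_Times V W)
  then show "\<exists>V. open V \<and> 0 \<in> V \<and> V \<subseteq> U \<and>
      (\<forall>x\<in>V. \<forall>y\<in>V. \<forall>u\<ge>0. \<forall>v\<ge>0. u + v = 1 \<longrightarrow> u *\<^sub>R x + v *\<^sub>R y \<in> V)"
    using V(1-3) W(1-3) AB(4) open_Times[OF V(1) W(1)]
    unfolding convex_def by (intro exI[of _ "V \<times> W"]) (auto simp: zero_prod_def)
qed

definition dir_quot :: "('e::locally_convex_space \<Rightarrow> 'f::locally_convex_space) \<Rightarrow> 'e \<Rightarrow> 'e \<Rightarrow> real \<Rightarrow> 'f"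
  where "dir_quot f x y t = (f (x + t *\<^sub>R y) - f x) /\<^sub>R t"

definition dir_deriv :: "('e::locally_convex_space \<Rightarrow> 'f::locally_convex_space) \<Rightarrow> 'e \<Rightarrow> 'e \<Rightarrow> 'f"
  where "dir_deriv f x y = Lim (at 0) (dir_quot f x y)"

text \<open>
  \<open>iter_deriv k f x y\<close> is $d^k f(x; y_0, \ldots, y_{k-1})$. The direction vectors are given
  by an infinite sequence of which only the first \<open>k\<close> entries matter; hence joint
  continuity in \<open>(x, y)\<close> for the product topology on \<^typ>\<open>nat \<Rightarrow> 'e\<close> is
  the same as joint continuity in $(x, y_0, \ldots, y_{k-1})$.
\<close>

primrec iter_deriv ::
  "nat \<Rightarrow> ('e::locally_convex_space \<Rightarrow> 'f::locally_convex_space) \<Rightarrow> 'e \<Rightarrow> (nat \<Rightarrow> 'e) \<Rightarrow> 'f" where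
  "iter_deriv 0 f x y = f x"
| "iter_deriv (Suc k) f x y = dir_deriv (\<lambda>z. iter_deriv k f z y) x (y k)"

text \<open>
  Only used for open \<open>U\<close>; the values of \<open>f\<close> outside \<open>U\<close> are then irrelevant.
\<close>

definition Cr_on ::
  "enat \<Rightarrow> 'e set \<Rightarrow> ('e::locally_convex_space \<Rightarrow> 'f::locally_convex_space) \<Rightarrow> bool" where
  "Cr_on r U f \<longleftrightarrow>
    (\<forall>k. enat (Suc k) \<le> r \<longrightarrow>
      (\<forall>x\<in>U. \<forall>y. \<exists>l. (dir_quot (\<lambda>z. iter_deriv k f z y) x (y k) \<longlongrightarrow> l) (at 0))) \<and>
    (\<forall>k. enat k \<le> r \<longrightarrow> continuous_on (U \<times> UNIV) (\<lambda>(x, y). iter_deriv k f x y))"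

text \<open>
  A chart is a pair of its domain and a function of which only the restriction to the domain
  matters. Thus a maximal atlas contains, with each chart, all those which agree with it on
  its domain.
\<close>

type_synonym ('m, 'e) chart = "'m set \<times> ('m \<Rightarrow> 'e)"

record ('m, 'e) mfd =
  mtop :: "'m topology"
  charts :: "('m, 'e) chart set"

abbreviation mcarrier :: "('m, 'e) mfd \<Rightarrow> 'm set"
  where "mcarrier M \<equiv> topspace (mtop M)"

definition is_chart :: "'m topology \<Rightarrow> ('m, 'e::locally_convex_space) chart \<Rightarrow> bool" where
  "is_chart X = (\<lambda>(U, \<phi>). openin X U \<and> open (\<phi> ` U) \<and>
     homeomorphic_map (subtopology X U) (top_of_set (\<phi> ` U)) \<phi>)"

definition Cr_transition ::
  "enat \<Rightarrow> ('m, 'e::locally_convex_space) chart \<Rightarrow> ('m, 'e) chart \<Rightarrow> bool" where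
  "Cr_transition r = (\<lambda>(U, \<phi>) (V, \<psi>). Cr_on r (\<phi> ` (U \<inter> V)) (\<psi> \<circ> inv_into U \<phi>))"

definition Cr_compatible ::
  "enat \<Rightarrow> ('m, 'e::locally_convex_space) chart \<Rightarrow> ('m, 'e) chart \<Rightarrow> bool" where
  "Cr_compatible r a b \<longleftrightarrow> Cr_transition r a b \<and> Cr_transition r b a"

definition Cr_atlas ::
  "enat \<Rightarrow> 'm topology \<Rightarrow> ('m, 'e::locally_convex_space) chart set \<Rightarrow> bool" where
  "Cr_atlas r X A \<longleftrightarrow> (\<forall>a\<in>A. is_chart X a) \<and> \<Union>(fst ` A) = topspace X \<and>
     (\<forall>a\<in>A. \<forall>b\<in>A. Cr_compatible r a b)"

definition maximal_atlas ::
  "enat \<Rightarrow> 'm topology \<Rightarrow> ('m, 'e::locally_convex_space) chart set \<Rightarrow> ('m, 'e) chart set" where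
  "maximal_atlas r X A = {c. is_chart X c \<and> (\<forall>a\<in>A. Cr_compatible r a c)}"

definition Cr_manifold :: "enat \<Rightarrow> ('m, 'e::locally_convex_space) mfd \<Rightarrow> bool" where
  "Cr_manifold r M \<longleftrightarrow> Hausdorff_space (mtop M) \<and> Cr_atlas r (mtop M) (charts M) \<and>
     maximal_atlas r (mtop M) (charts M) = charts M"

definition lcs_manifold :: "enat \<Rightarrow> ('e::locally_convex_space, 'e) mfd" where
  "lcs_manifold r = \<lparr>mtop = euclidean, charts = maximal_atlas r euclidean {(UNIV, id)}\<rparr>"

definition prod_manifold ::
  "enat \<Rightarrow> ('m, 'e::locally_convex_space) mfd \<Rightarrow> ('n, 'f::locally_convex_space) mfd \<Rightarrow>
   ('m \<times> 'n, 'e \<times> 'f) mfd" where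
  "prod_manifold r M N =
    (let X = prod_topology (mtop M) (mtop N)
     in \<lparr>mtop = X,
         charts = maximal_atlas r X
           {(U \<times> V, map_prod \<phi> \<psi>) | U \<phi> V \<psi>. (U, \<phi>) \<in> charts M \<and> (V, \<psi>) \<in> charts N}\<rparr>)"

text \<open>
  \<open>C\<^sup>r\<close>-maps on an open subset \<open>W\<close> of a manifold. The atlases of \<open>M\<close> and \<open>N\<close> may consist of
  charts with transition maps smoother than \<open>C\<^sup>r\<close>; in particular a smooth manifold is
  used as a \<open>C\<^sup>1\<close>-manifold without enlarging its atlas.
\<close>

definition Cr_map_on ::
  "enat \<Rightarrow> ('m, 'e::locally_convex_space) mfd \<Rightarrow> ('n, 'f::locally_convex_space) mfd \<Rightarrow>
   'm set \<Rightarrow> ('m \<Rightarrow> 'n) \<Rightarrow> bool" where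
  "Cr_map_on r M N W f \<longleftrightarrow> openin (mtop M) W \<and>
     continuous_map (subtopology (mtop M) W) (mtop N) f \<and>
     (\<forall>(U, \<phi>) \<in> charts M. \<forall>(V, \<psi>) \<in> charts N.
        Cr_on r (\<phi> ` {p \<in> W \<inter> U. f p \<in> V}) (\<psi> \<circ> f \<circ> inv_into U \<phi>))"

abbreviation Cr_map ::
  "enat \<Rightarrow> ('m, 'e::locally_convex_space) mfd \<Rightarrow> ('n, 'f::locally_convex_space) mfd \<Rightarrow>
   ('m \<Rightarrow> 'n) \<Rightarrow> bool" where
  "Cr_map r M N f \<equiv> Cr_map_on r M N (mcarrier M) f"

text \<open>
  Tangent vectors at \<open>p\<close> are equivalence classes of \<open>C\<^sup>1\<close>-curves through \<open>p\<close>, defined near \<open>0\<close>.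
\<close>

definition C1_curve :: "('m, 'e::locally_convex_space) mfd \<Rightarrow> 'm \<Rightarrow> (real \<Rightarrow> 'm) \<Rightarrow> bool" where
  "C1_curve M p c \<longleftrightarrow> c 0 = p \<and> (\<exists>\<epsilon>>0. Cr_map_on 1 (lcs_manifold 1) M {-\<epsilon><..<\<epsilon>} c)"

definition tangent_rel ::
  "('m, 'e::locally_convex_space) mfd \<Rightarrow> 'm \<Rightarrow> ((real \<Rightarrow> 'm) \<times> (real \<Rightarrow> 'm)) set" where
  "tangent_rel M p = {(c, d). C1_curve M p c \<and> C1_curve M p d \<and>
     (\<forall>(U, \<phi>) \<in> charts M. p \<in> U \<longrightarrow> dir_deriv (\<phi> \<circ> c) 0 1 = dir_deriv (\<phi> \<circ> d) 0 1)}"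

definition tangent_space :: "('m, 'e::locally_convex_space) mfd \<Rightarrow> 'm \<Rightarrow> (real \<Rightarrow> 'm) set set" where
  "tangent_space M p = {c. C1_curve M p c} // tangent_rel M p"

definition velocity :: "('m, 'e::locally_convex_space) mfd \<Rightarrow> (real \<Rightarrow> 'm) \<Rightarrow> (real \<Rightarrow> 'm) set" where
  "velocity M c = tangent_rel M (c 0) `` {c}"

definition tangent_map ::
  "('n, 'f::locally_convex_space) mfd \<Rightarrow> ('m \<Rightarrow> 'n) \<Rightarrow> (real \<Rightarrow> 'm) set \<Rightarrow> (real \<Rightarrow> 'n) set" where
  "tangent_map N f v = (\<Union>c\<in>v. velocity N (f \<circ> c))"

definition smooth_submersion ::
  "('m, 'e::locally_convex_space) mfd \<Rightarrow> ('n, 'f::locally_convex_space) mfd \<Rightarrow> ('m \<Rightarrow> 'n) \<Rightarrow> bool"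
  where
  "smooth_submersion M N f \<longleftrightarrow> Cr_map \<infinity> M N f \<and>
    (\<forall>x\<in>mcarrier M. \<exists>(U, \<phi>) \<in> charts M. \<exists>(V, \<psi>) \<in> charts N. x \<in> U \<and> f ` U \<subseteq> V \<and>
       (\<exists>\<pi> :: 'e \<Rightarrow> 'f. linear \<pi> \<and> continuous_on UNIV \<pi> \<and>
          (\<exists>s. linear s \<and> continuous_on UNIV s \<and> \<pi> \<circ> s = id) \<and>
          (\<forall>z \<in> \<phi> ` U. (\<psi> \<circ> f \<circ> inv_into U \<phi>) z = \<pi> z)))"

locale lie_group = group G for G :: "('g, 'b) monoid_scheme" (structure) +
  fixes MG :: "('g, 'e::locally_convex_space) mfd"
  assumes smooth_manifold: "Cr_manifold \<infinity> MG"
    and carrier_eq: "mcarrier MG = carrier G"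
    and smooth_mult: "Cr_map \<infinity> (prod_manifold \<infinity> MG MG) MG (\<lambda>(g, h). g \<otimes> h)"
    and smooth_inv: "Cr_map \<infinity> MG MG (\<lambda>g. inv g)"

definition has_exponential ::
  "('g, 'b) monoid_scheme \<Rightarrow> ('g, 'e::locally_convex_space) mfd \<Rightarrow> bool" where
  "has_exponential G MG \<longleftrightarrow>
    (\<forall>v \<in> tangent_space MG \<one>\<^bsub>G\<^esub>. \<exists>\<gamma>. Cr_map \<infinity> (lcs_manifold \<infinity> :: (real, real) mfd) MG \<gamma> \<and>
       (\<forall>s t. \<gamma> (s + t) = \<gamma> s \<otimes>\<^bsub>G\<^esub> \<gamma> t) \<and> velocity MG \<gamma> = v)"

text \<open>
  \<^const>\<open>group_action\<close> makes each \<open>\<sigma> g\<close> a permutation of the points of \<open>M\<close>, extended by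
  \<^term>\<open>undefined\<close> outside them.
\<close>

locale C1_action = group_action G "mcarrier M" \<sigma>
  for G :: "('g, 'b) monoid_scheme" (structure)
    and MG :: "('g, 'e::locally_convex_space) mfd"
    and M :: "('m, 'f::locally_convex_space) mfd"
    and \<sigma> :: "'g \<Rightarrow> 'm \<Rightarrow> 'm" +
  assumes C1_manifold: "Cr_manifold 1 M"
    and C1_action: "Cr_map 1 (prod_manifold 1 MG M) M (\<lambda>(g, y). \<sigma> g y)"

definition coset_orbit_map :: "('g \<Rightarrow> 'm \<Rightarrow> 'm) \<Rightarrow> 'm \<Rightarrow> 'g set \<Rightarrow> 'm" where
  "coset_orbit_map \<sigma> x C = (THE y. \<forall>g\<in>C. y = \<sigma> g x)"

end

theory Submission
  imports Defs
begin

text \<open>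
  Suppose that two tangent vectors of \<open>G/G\<^sub>x\<close> at \<open>gG\<^sub>x\<close> have the same image. The submersion has
  local sections of the form \<open>\<phi>\<inverse> \<circ> (affine map) \<circ> \<psi>\<close>, so representing curves lift to curves through \<open>g\<close>
  in \<open>G\<close>, and after translation by \<open>g\<inverse>\<close> the lifts have velocities \<open>u\<^sub>1\<close>, \<open>u\<^sub>2\<close> in \<open>L(G)\<close> on which the
  tangent map of the orbit map agrees. Let \<open>\<gamma>\<close> be the one-parameter group with velocity \<open>u\<^sub>1 - u\<^sub>2\<close>. The
  curve \<open>\<gamma>(t)x\<close> has velocity \<open>0\<close> at \<open>t = 0\<close>, hence at every \<open>t\<close> by equivariance, and so is constant: \<open>\<gamma>\<close>
  stays in the stabilizer. Therefore \<open>g\<gamma>(t)G\<^sub>x\<close> is constant, \<open>u\<^sub>1 - u\<^sub>2\<close> is annihilated by the tangent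
  map of \<open>h \<mapsto> ghG\<^sub>x\<close>, and the two given vectors coincide.
\<close>

section \<open>Calculus in locally convex spaces\<close>

text \<open>The exponential function is not assumed to be continuous, so it provides no charts, and
  in general locally convex model spaces there is neither an inverse function theorem nor a
  uniqueness theorem for differential equations. The mean value theorem takes their place: it makes
  a curve with vanishing velocity constant. An arbitrary curve with velocity
  \<open>u\<^sub>1 - u\<^sub>2\<close> would not do, since its image in \<open>M\<close> would have
  zero velocity only at time 0; the homomorphism property spreads this to all times.

  Tangent spaces are bare sets of classes of curves. Injectivity is therefore shown by comparing two
  vectors and not by computing a kernel; differences of velocities are formed in charts, which is
  why tangent maps are carried along as additive maps between model spaces.\<close>

lemma tendsto_scaleR_lcs:
  fixes g :: "'i \<Rightarrow> 'a::locally_convex_space"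
  assumes "(f \<longlongrightarrow> r) F" "(g \<longlongrightarrow> x) F"
  shows "((\<lambda>i. f i *\<^sub>R g i) \<longlongrightarrow> r *\<^sub>R x) F"
  using filterlim_compose[OF tendsto_scaleR_nhds filterlim_Pair[OF assms]] by simp

lemma open_vimage_plus:
  fixes N :: "'a::topological_group_add set"
  assumes "open N"
  shows "open {y. a + y \<in> N}"
proof -
  have "continuous_on UNIV (\<lambda>y. a + y)" by (intro continuous_intros)
  from open_vimage[OF assms this] show ?thesis by (simp add: vimage_def)
qed

lemma convex_nhd:
  fixes x :: "'a::locally_convex_space"
  assumes "open N" "x \<in> N"
  obtains K where "open K" "convex K" "x \<in> K" "K \<subseteq> N"
proof -
  have "0 \<in> {y. x + y \<in> N}" using assms(2) by simp
  then obtain V where V: "open V" "0 \<in> V" "V \<subseteq> {y. x + y \<in> N}" "convex V"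
    using locally_convex_space_convex_nhd[OF open_vimage_plus[OF assms(1)]] by metis
  have "open {y. - x + y \<in> V}" by (rule open_vimage_plus[OF V(1)])
  moreover have "{y. - x + y \<in> V} = (+) x ` V"
  proof (intro equalityI subsetI)
    fix y assume "y \<in> {y. - x + y \<in> V}"
    then show "y \<in> (+) x ` V" by (intro image_eqI[of y _ "- x + y"]) simp_all
  qed auto
  moreover have "x \<in> (+) x ` V" using V(2) by (intro image_eqI[of x _ 0]) simp_all
  moreover have "(+) x ` V \<subseteq> N" using V(3) by blast
  ultimately show ?thesis
    using that[of "(+) x ` V"] convex_translation[OF V(4), of x] by simp
qed

text \<open>The difference quotient over an interval is a convex combination of those over two
  adjacent parts, so lying in \<open>K\<close> survives concatenation. Bisection then reduces the
  claim to short intervals around a point, where openness of \<open>K\<close> and the limit defining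
  the derivative suffice. Neither functionals nor integrals enter.\<close>

lemma mean_value_convex:
  fixes h :: "real \<Rightarrow> 'a::locally_convex_space"
  assumes "a < b" and K: "open K" "convex K"
    and h: "\<And>s. a \<le> s \<Longrightarrow> s \<le> b \<Longrightarrow> (dir_quot h s 1 \<longlongrightarrow> h' s) (at 0)"
           "\<And>s. a \<le> s \<Longrightarrow> s \<le> b \<Longrightarrow> h' s \<in> K"
  shows "(h b - h a) /\<^sub>R (b - a) \<in> K"
proof -
  \<comment> \<open>Degenerate intervals count as good: splitting at \<open>x\<close> may leave an
    empty half, whose quotient evaluates to 0, and 0 need not lie in \<open>K\<close>.\<close>
  define P where "P = (\<lambda>a b. a = b \<or> (h b - h a) /\<^sub>R (b - a) \<in> K)"
  have trans: "P a c" if "P a b" "P b c" "a \<le> b" "b \<le> c" for a b c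
  proof (cases "a = b \<or> b = c")
    case True then show ?thesis using that by auto
  next
    case False
    with that have lt: "a < b" "b < c" by auto
    with False that have in_K: "(h b - h a) /\<^sub>R (b - a) \<in> K" "(h c - h b) /\<^sub>R (c - b) \<in> K"
      by (auto simp: P_def)
    have weights: "(b-a)/(c-a) + (c-b)/(c-a) = 1"
      using lt by (subst add_divide_distrib[symmetric]) simp
    have "((b-a)/(c-a)) *\<^sub>R ((h b - h a) /\<^sub>R (b - a)) + ((c-b)/(c-a)) *\<^sub>R ((h c - h b) /\<^sub>R (c - b)) \<in> K"
      using lt by (intro convexD[OF K(2)] in_K weights) auto
    also have "((b-a)/(c-a)) *\<^sub>R ((h b - h a) /\<^sub>R (b - a)) = (h b - h a) /\<^sub>R (c - a)"
      using lt by (simp add: field_simps)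
    also have "((c-b)/(c-a)) *\<^sub>R ((h c - h b) /\<^sub>R (c - b)) = (h c - h b) /\<^sub>R (c - a)"
      using lt by (simp add: field_simps)
    also have "(h b - h a) /\<^sub>R (c - a) + (h c - h b) /\<^sub>R (c - a) = (h c - h a) /\<^sub>R (c - a)"
      by (simp flip: scaleR_add_right)
    finally show ?thesis by (simp add: P_def)
  qed
  from \<open>a < b\<close> have "a \<le> b" by simp
  then have "P a b"
  proof (induction rule: Bolzano)
    case (trans a b c)
    then show ?case using \<open>\<And>a b c. P a b \<Longrightarrow> P b c \<Longrightarrow> a \<le> b \<Longrightarrow> b \<le> c \<Longrightarrow> P a c\<close> by blast
  next
    case (local x)
    have "\<forall>\<^sub>F t in at 0. dir_quot h x 1 t \<in> K"
      using h[OF local] K(1) by (auto simp: tendsto_def)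
    then obtain d where d: "d > 0" "\<And>t. t \<noteq> 0 \<Longrightarrow> \<bar>t\<bar> < d \<Longrightarrow> dir_quot h x 1 t \<in> K"
      by (auto simp: eventually_at dist_real_def)
    have "P a' b'" if "a' \<le> x" "x \<le> b'" "b' - a' < d" for a' b'
    proof (rule trans)
      \<comment> \<open>Reversing both differences turns the quotient to the left of
        \<open>x\<close> into the one at \<open>x\<close> with negative increment, so the two-sided
        limit covers both halves.\<close>
      have "(h x - h a') /\<^sub>R (x - a') = dir_quot h x 1 (a' - x)" if "a' \<noteq> x"
        using scaleR_minus_right[of "inverse (a' - x)" "h x - h a'"]
        unfolding dir_quot_def by (simp flip: scaleR_minus_left) (metis inverse_minus_eq minus_diff_eq scaleR_minus_left)
      then show "P a' x" using d(2)[of "a' - x"] that by (cases "a' = x") (auto simp: P_def)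
      show "P x b'" using d(2)[of "b' - x"] that by (cases "b' = x") (auto simp: P_def dir_quot_def)
    qed (use that in auto)
    then show ?case using d(1) by blast
  qed
  then show ?thesis using \<open>a < b\<close> by (auto simp: P_def)
qed

text \<open>In a Hausdorff space a nonzero difference quotient can be separated from 0 by a convex
  neighbourhood of 0, and the mean value theorem forbids this.\<close>

lemma constant_if_deriv_zero:
  fixes h :: "real \<Rightarrow> 'a::locally_convex_space"
  assumes h: "\<And>s. a \<le> s \<Longrightarrow> s \<le> b \<Longrightarrow> (dir_quot h s 1 \<longlongrightarrow> 0) (at 0)" and "a < b"
  shows "h b = h a"
proof (rule ccontr)
  assume "h b \<noteq> h a"
  define z where "z = (h b - h a) /\<^sub>R (b - a)"
  have "z \<noteq> 0" using \<open>h b \<noteq> h a\<close> \<open>a < b\<close> by (auto simp: z_def)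
  then have "open (- {z})" "0 \<in> - {z}" by (simp_all add: open_Compl)
  then obtain K where "open K" "convex K" "0 \<in> K" "K \<subseteq> - {z}"
    by (rule convex_nhd)
  then show False using mean_value_convex[OF \<open>a < b\<close>, of K h "\<lambda>_. 0"] h by (auto simp: z_def)
qed

section \<open>Calculus of C^1 maps\<close>

lemma dir_deriv_eqI: "(dir_quot f x v \<longlongrightarrow> l) (at 0) \<Longrightarrow> dir_deriv f x v = l"
  unfolding dir_deriv_def by (rule tendsto_Lim) simp_all

lemma Cr_on_mono: "Cr_on r U f \<Longrightarrow> V \<subseteq> U \<Longrightarrow> Cr_on r V f"
  unfolding Cr_on_def by (meson Sigma_mono continuous_on_subset order_refl subsetD)

lemma Cr_on_le: "Cr_on r U f \<Longrightarrow> s \<le> r \<Longrightarrow> Cr_on s U f"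
  unfolding Cr_on_def by (meson order_trans)

lemma Cr_on_continuous:
  assumes "Cr_on r U f"
  shows "continuous_on U f"
proof -
  have *: "continuous_on (U \<times> UNIV) (\<lambda>(x, y::nat \<Rightarrow> 'a). f x)"
    using assms by (auto simp: Cr_on_def dest: spec[of _ 0] simp flip: zero_enat_def)
  have "continuous_on U (\<lambda>x. (x, \<lambda>_::nat. 0::'a))"
    by (intro continuous_intros)
  from continuous_on_compose2[OF * this] show ?thesis by auto
qed

text \<open>Of the infinite sequence of directions only entry 0 matters at order one. Pulling back
  along constant sequences, respectively along the projection to entry 0, exchanges continuity in
  the sequence for continuity in a single direction.\<close>

lemma C1_on_iff:
  "Cr_on 1 U f \<longleftrightarrow> continuous_on U f \<and>
    (\<forall>x\<in>U. \<forall>v. (dir_quot f x v \<longlongrightarrow> dir_deriv f x v) (at 0)) \<and>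
    continuous_on (U \<times> UNIV) (\<lambda>(x, v). dir_deriv f x v)"  (is "?L \<longleftrightarrow> ?C \<and> ?D \<and> ?E")
proof -
  have all_le: "(\<forall>k. enat k \<le> 1 \<longrightarrow> P k) \<longleftrightarrow> P 0 \<and> P 1"
      "(\<forall>k. enat (Suc k) \<le> 1 \<longrightarrow> P k) \<longleftrightarrow> P 0" for P
    by (auto simp: one_enat_def le_Suc_eq)
  have 1: "?L \<longleftrightarrow> (\<forall>x\<in>U. \<forall>y::nat \<Rightarrow> 'a. \<exists>l. (dir_quot f x (y 0) \<longlongrightarrow> l) (at 0)) \<and>
       continuous_on (U \<times> UNIV) (\<lambda>(x, y::nat \<Rightarrow> 'a). f x) \<and>
       continuous_on (U \<times> UNIV) (\<lambda>(x, y::nat \<Rightarrow> 'a). dir_deriv f x (y 0))"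
    unfolding Cr_on_def all_le by (simp add: case_prod_unfold)
  have 2: "(\<forall>x\<in>U. \<forall>y::nat \<Rightarrow> 'a. \<exists>l. (dir_quot f x (y 0) \<longlongrightarrow> l) (at 0)) \<longleftrightarrow> ?D"
  proof
    assume *: "\<forall>x\<in>U. \<forall>y::nat \<Rightarrow> 'a. \<exists>l. (dir_quot f x (y 0) \<longlongrightarrow> l) (at 0)"
    show ?D
    proof (intro ballI allI)
      fix x v assume "x \<in> U"
      then obtain l where "(dir_quot f x v \<longlongrightarrow> l) (at 0)" using *[rule_format, of x "\<lambda>_. v"] by auto
      then show "(dir_quot f x v \<longlongrightarrow> dir_deriv f x v) (at 0)" using dir_deriv_eqI by metis
    qed
  qed blast
  have inc: "continuous_on S (\<lambda>x. (x, \<lambda>_::nat. 0::'a))" for S :: "'a set"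
    by (intro continuous_intros)
  have const: "continuous_on S (\<lambda>p. (fst p, \<lambda>_::nat. snd p))" for S :: "('a \<times> 'a) set"
    by (intro continuous_intros)
  have coord: "continuous_on S (\<lambda>p. (fst p, snd p 0))" for S :: "('a \<times> (nat \<Rightarrow> 'a)) set"
    by (intro continuous_intros continuous_on_compose2[OF continuous_on_product_coordinates continuous_on_snd[OF continuous_on_id]]) auto
  have 3: "continuous_on (U \<times> UNIV) (\<lambda>(x, y::nat \<Rightarrow> 'a). f x) \<longleftrightarrow> ?C"
  proof
    assume *: "continuous_on (U \<times> UNIV) (\<lambda>(x, y::nat \<Rightarrow> 'a). f x)"
    from continuous_on_compose2[OF * inc[of U]] show ?C by auto
  next
    assume ?C
    from continuous_on_compose2[OF this continuous_on_fst[OF continuous_on_id], of "U \<times> UNIV"]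
    show "continuous_on (U \<times> UNIV) (\<lambda>(x, y::nat \<Rightarrow> 'a). f x)" by (auto simp: case_prod_unfold)
  qed
  have 4: "continuous_on (U \<times> UNIV) (\<lambda>(x, y::nat \<Rightarrow> 'a). dir_deriv f x (y 0)) \<longleftrightarrow> ?E"
  proof
    assume *: "continuous_on (U \<times> UNIV) (\<lambda>(x, y::nat \<Rightarrow> 'a). dir_deriv f x (y 0))"
    from continuous_on_compose2[OF * const[of "U \<times> UNIV"]] show ?E
      by (simp add: case_prod_unfold image_subset_iff)
  next
    assume ?E
    from continuous_on_compose2[OF this coord[of "U \<times> UNIV"]]
    show "continuous_on (U \<times> UNIV) (\<lambda>(x, y::nat \<Rightarrow> 'a). dir_deriv f x (y 0))"
      by (simp add: case_prod_unfold image_subset_iff)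
  qed
  show ?thesis using 1 2 3 4 by blast
qed

lemma C1_onI:
  assumes "continuous_on U f"
    and "\<And>x v. x \<in> U \<Longrightarrow> (dir_quot f x v \<longlongrightarrow> D x v) (at 0)"
    and "continuous_on (U \<times> UNIV) (\<lambda>p. D (fst p) (snd p))"
  shows "Cr_on 1 U f"
proof -
  have "dir_deriv f x v = D x v" if "x \<in> U" for x v
    using assms(2)[OF that] by (rule dir_deriv_eqI)
  moreover from this have "continuous_on (U \<times> UNIV) (\<lambda>p. dir_deriv f (fst p) (snd p))"
    by (intro continuous_on_eq[OF assms(3)]) auto
  ultimately show ?thesis using assms by (simp add: C1_on_iff case_prod_unfold)
qed

text \<open>
  The mean value theorem applied to \<open>s \<mapsto> f (y + s t w) / t\<close> on the unit interval. This one limit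
  yields the chain rule as well as the additivity of the derivative.
\<close>

lemma C1_strict_derivative:
  fixes f :: "'a::locally_convex_space \<Rightarrow> 'b::locally_convex_space"
  assumes f: "Cr_on 1 U f" and U: "open U" "x \<in> U"
    and lim: "(Y \<longlongrightarrow> x) F" "(T \<longlongrightarrow> (0::real)) F" "\<forall>\<^sub>F i in F. T i \<noteq> 0" "(W \<longlongrightarrow> v) F"
  shows "((\<lambda>i. (f (Y i + T i *\<^sub>R W i) - f (Y i)) /\<^sub>R T i) \<longlongrightarrow> dir_deriv f x v) F"
proof (rule topological_tendstoI)
  fix N assume N: "open N" "dir_deriv f x v \<in> N"
  note f' = f[unfolded C1_on_iff]
  obtain K where K: "open K" "convex K" "dir_deriv f x v \<in> K" "K \<subseteq> N"
    using convex_nhd[OF N] .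
  have "open ((\<lambda>(x, v). dir_deriv f x v) -` K \<inter> U \<times> UNIV)"
    using f' K(1) U(1) by (intro continuous_open_preimage[where S="U \<times> UNIV", unfolded Int_commute[of "U \<times> UNIV"]]) (auto intro: open_Times)
  moreover have "(x, v) \<in> (\<lambda>(x, v). dir_deriv f x v) -` K \<inter> U \<times> UNIV" using K U by auto
  ultimately obtain A B where AB: "open A" "open B" "(x, v) \<in> A \<times> B"
      "A \<times> B \<subseteq> (\<lambda>(x, v). dir_deriv f x v) -` K \<inter> U \<times> UNIV"
    by (rule open_prod_elim)
  \<comment> \<open>The base points are shrunk to a convex set so that the whole segment from
    \<open>Y i\<close> to \<open>Y i + T i *\<^sub>R W i\<close> stays where the derivative in
    direction \<open>W i\<close> lies in \<open>K\<close>.\<close>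
  obtain C where C: "open C" "convex C" "x \<in> C" "C \<subseteq> A"
    using convex_nhd[OF AB(1), of x] AB(3) by (metis mem_Sigma_iff)
  have "((\<lambda>i. Y i + T i *\<^sub>R W i) \<longlongrightarrow> x + 0 *\<^sub>R v) F"
    by (intro tendsto_add tendsto_scaleR_lcs lim)
  then have "\<forall>\<^sub>F i in F. Y i + T i *\<^sub>R W i \<in> C" using C by (simp add: topological_tendstoD)
  moreover have "\<forall>\<^sub>F i in F. Y i \<in> C" "\<forall>\<^sub>F i in F. W i \<in> B"
    using C AB lim by (auto intro: topological_tendstoD)
  ultimately show "\<forall>\<^sub>F i in F. (f (Y i + T i *\<^sub>R W i) - f (Y i)) /\<^sub>R T i \<in> N"
    using lim(3)
  proof eventually_elim
    case (elim i)
    define y t w where "y = Y i" "t = T i" "w = W i"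
    define h where "h = (\<lambda>s. f (y + (s * t) *\<^sub>R w) /\<^sub>R t)"
    have t: "t \<noteq> 0" and w: "w \<in> B" using elim by (auto simp: y_t_w_def)
    have in_K: "dir_deriv f a w \<in> K" if "a \<in> C" for a
    proof -
      have "(a, w) \<in> (\<lambda>(x, v). dir_deriv f x v) -` K \<inter> U \<times> UNIV"
        using AB(4) C(4) w that by blast
      then show ?thesis by simp
    qed
    have seg: "y + (s * t) *\<^sub>R w \<in> C" if "0 \<le> s" "s \<le> 1" for s
    proof -
      have "(1 - s) *\<^sub>R y + s *\<^sub>R (y + t *\<^sub>R w) \<in> C"
        using that elim C(2) by (intro convexD) (auto simp: y_t_w_def)
      also have "(1 - s) *\<^sub>R y + s *\<^sub>R (y + t *\<^sub>R w) = y + (s * t) *\<^sub>R w"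
        by (simp add: algebra_simps)
      finally show ?thesis .
    qed
    have der: "(dir_quot h s 1 \<longlongrightarrow> dir_deriv f (y + (s * t) *\<^sub>R w) w) (at 0)" if "0 \<le> s" "s \<le> 1" for s
    proof -
      have "(dir_quot f (y + (s * t) *\<^sub>R w) w \<longlongrightarrow> dir_deriv f (y + (s * t) *\<^sub>R w) w) (at 0)"
        using f' seg[OF that] w AB(4) C(4) by blast
      moreover have "filterlim (\<lambda>r. r * t) (at 0) (at 0)"
        using t by (auto simp: filterlim_at eventually_at intro!: tendsto_eq_intros exI[of _ 1])
      ultimately have "((\<lambda>r. dir_quot f (y + (s * t) *\<^sub>R w) w (r * t)) \<longlongrightarrow> dir_deriv f (y + (s * t) *\<^sub>R w) w) (at 0)"
        by (rule filterlim_compose)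
      moreover have "dir_quot f (y + (s * t) *\<^sub>R w) w (r * t) = dir_quot h s 1 r" for r
        by (simp add: dir_quot_def h_def algebra_simps)
      ultimately show ?thesis by simp
    qed
    have "(h 1 - h 0) /\<^sub>R (1 - 0) \<in> K"
      by (rule mean_value_convex[OF _ K(1,2) der]) (use seg in_K in auto)
    then show ?case using K(4) by (auto simp: h_def y_t_w_def scaleR_diff_right)
  qed
qed

lemma C1_dir_quot_tendsto:
  "Cr_on 1 U f \<Longrightarrow> x \<in> U \<Longrightarrow> (dir_quot f x v \<longlongrightarrow> dir_deriv f x v) (at 0)"
  by (simp add: C1_on_iff)

text \<open>The increment along \<open>u + v\<close> is taken in two steps, first along
  \<open>u\<close> and then along \<open>v\<close>. The second quotient has the moving base point
  \<open>x + t *\<^sub>R u\<close>, which the strict form of the derivative permits.\<close>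

lemma dir_deriv_add:
  assumes f: "Cr_on 1 U f" and U: "open U" "x \<in> U"
  shows "dir_deriv f x (u + v) = dir_deriv f x u + dir_deriv f x v"
proof (rule dir_deriv_eqI)
  have T: "((\<lambda>t. x + t *\<^sub>R u) \<longlongrightarrow> x) (at 0)"
    by (rule tendsto_eq_rhs[OF tendsto_add[OF tendsto_const tendsto_scaleR_lcs[OF tendsto_ident_at tendsto_const]]]) simp
  have "((\<lambda>t. dir_quot f x u t + (f ((x + t *\<^sub>R u) + t *\<^sub>R v) - f (x + t *\<^sub>R u)) /\<^sub>R t) \<longlongrightarrow>
      dir_deriv f x u + dir_deriv f x v) (at 0)"
    by (intro tendsto_add C1_dir_quot_tendsto[OF f U(2)] C1_strict_derivative[OF f U] T tendsto_ident_at tendsto_const)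
      (simp add: eventually_at_filter)
  moreover have "dir_quot f x u t + (f ((x + t *\<^sub>R u) + t *\<^sub>R v) - f (x + t *\<^sub>R u)) /\<^sub>R t = dir_quot f x (u + v) t" for t
    by (simp add: dir_quot_def algebra_simps)
  ultimately show "(dir_quot f x (u + v) \<longlongrightarrow> dir_deriv f x u + dir_deriv f x v) (at 0)" by simp
qed

text \<open>The strict derivative of \<open>f\<close> is taken along the variable direction
  \<open>dir_quot g x v t\<close>, which tends to \<open>l\<close>. Of \<open>g\<close> only this
  one limit is used, so the rule also serves curves known to be differentiable at a single
  time.\<close>

lemma dir_quot_chain:
  assumes f: "Cr_on 1 V f" and V: "open V" "g x \<in> V" and g: "(dir_quot g x v \<longlongrightarrow> l) (at 0)"
  shows "(dir_quot (f \<circ> g) x v \<longlongrightarrow> dir_deriv f (g x) l) (at 0)"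
proof -
  have "((\<lambda>t. (f (g x + t *\<^sub>R dir_quot g x v t) - f (g x)) /\<^sub>R t) \<longlongrightarrow> dir_deriv f (g x) l) (at 0)"
    by (intro C1_strict_derivative[OF f V] tendsto_const tendsto_ident_at g) (simp add: eventually_at_filter)
  moreover have "\<forall>\<^sub>F t in at 0. (f (g x + t *\<^sub>R dir_quot g x v t) - f (g x)) /\<^sub>R t = dir_quot (f \<circ> g) x v t"
    by (simp add: eventually_at_filter dir_quot_def)
  ultimately show ?thesis by (rule Lim_transform_eventually)
qed

lemma C1_on_compose:
  assumes g: "Cr_on 1 U g" and f: "Cr_on 1 V f" and "open V" "g ` U \<subseteq> V"
  shows "Cr_on 1 U (f \<circ> g)"
proof (rule C1_onI)
  show "continuous_on U (f \<circ> g)"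
    by (rule continuous_on_compose[OF Cr_on_continuous[OF g] continuous_on_subset[OF Cr_on_continuous[OF f] assms(4)]])
  show "(dir_quot (f \<circ> g) x v \<longlongrightarrow> dir_deriv f (g x) (dir_deriv g x v)) (at 0)" if "x \<in> U" for x v
    using that assms by (intro dir_quot_chain[OF f] C1_dir_quot_tendsto[OF g]) auto
  have "continuous_on (U \<times> (UNIV::'a set)) (\<lambda>p. g (fst p))"
    by (rule continuous_on_compose2[OF Cr_on_continuous[OF g] continuous_on_fst[OF continuous_on_id]]) auto
  then have 1: "continuous_on (U \<times> UNIV) (\<lambda>p. (g (fst p), dir_deriv g (fst p) (snd p)))"
    using g by (intro continuous_on_Pair) (simp_all add: C1_on_iff case_prod_unfold)
  have "continuous_on (V \<times> UNIV) (\<lambda>p. dir_deriv f (fst p) (snd p))"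
    using f by (simp add: C1_on_iff case_prod_unfold)
  from continuous_on_compose2[OF this 1]
  show "continuous_on (U \<times> UNIV) (\<lambda>p. dir_deriv f (g (fst p)) (dir_deriv g (fst p) (snd p)))"
    using assms(4) by (simp add: image_subset_iff)
qed

lemma C1_on_affine:
  assumes "linear s" "continuous_on UNIV s"
  shows "Cr_on 1 U (\<lambda>z. a + s z)"
proof (rule C1_onI)
  show "continuous_on U (\<lambda>z. a + s z)"
    by (intro continuous_intros continuous_on_subset[OF assms(2)]) auto
  have "\<forall>\<^sub>F t in at 0. s v = dir_quot (\<lambda>z. a + s z) x v t" for x v
    by (simp add: eventually_at_filter dir_quot_def linear_add[OF assms(1)] linear_scale[OF assms(1)])
  then show "(dir_quot (\<lambda>z. a + s z) x v \<longlongrightarrow> s v) (at 0)" for x v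
    by (rule Lim_transform_eventually[OF tendsto_const])
  show "continuous_on (U \<times> UNIV) (\<lambda>p. s (snd p))"
    by (rule continuous_on_compose2[OF assms(2)]) (auto intro!: continuous_intros)
qed

lemma dir_quot_Pair: "dir_quot (\<lambda>x. (f x, g x)) x v t = (dir_quot f x v t, dir_quot g x v t)"
  by (simp add: dir_quot_def scaleR_prod_def)

lemma C1_on_Pair:
  assumes f: "Cr_on 1 U f" and g: "Cr_on 1 U g"
  shows "Cr_on 1 U (\<lambda>x. (f x, g x))"
proof (rule C1_onI)
  show "continuous_on U (\<lambda>x. (f x, g x))"
    using Cr_on_continuous[OF f] Cr_on_continuous[OF g] by (rule continuous_on_Pair)
  show "(dir_quot (\<lambda>x. (f x, g x)) x v \<longlongrightarrow> (dir_deriv f x v, dir_deriv g x v)) (at 0)" if "x \<in> U" for x v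
    unfolding dir_quot_Pair using that by (intro tendsto_Pair C1_dir_quot_tendsto[OF f] C1_dir_quot_tendsto[OF g])
  show "continuous_on (U \<times> UNIV) (\<lambda>p. (dir_deriv f (fst p) (snd p), dir_deriv g (fst p) (snd p)))"
    using f g by (auto simp: C1_on_iff case_prod_unfold intro!: continuous_on_Pair)
qed

section \<open>Maps of arbitrary order: locality and products\<close>

lemma Cr_on_dir_quot_tendsto:
  assumes "Cr_on r U f" "enat (Suc k) \<le> r" "x \<in> U"
  shows "(dir_quot (\<lambda>z. iter_deriv k f z y) x (y k) \<longlongrightarrow> iter_deriv (Suc k) f x y) (at 0)"
proof -
  obtain l where "(dir_quot (\<lambda>z. iter_deriv k f z y) x (y k) \<longlongrightarrow> l) (at 0)"
    using assms unfolding Cr_on_def by blast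
  then show ?thesis using dir_deriv_eqI by fastforce
qed

lemma dir_quot_cong_eventually:
  assumes "open U" "\<And>x. x \<in> U \<Longrightarrow> f x = g x" "x \<in> U"
  shows "\<forall>\<^sub>F t in at 0. dir_quot f x v t = dir_quot g x v t"
proof -
  have "((\<lambda>t. x + t *\<^sub>R v) \<longlongrightarrow> x + 0 *\<^sub>R v) (at 0)"
    by (intro tendsto_add tendsto_scaleR_lcs tendsto_const tendsto_ident_at)
  then have "\<forall>\<^sub>F t in at 0. x + t *\<^sub>R v \<in> U"
    using assms(1,3) by (simp add: topological_tendstoD)
  then show ?thesis by eventually_elim (simp add: dir_quot_def assms)
qed

lemma iter_deriv_cong:
  assumes "open U" "\<And>x. x \<in> U \<Longrightarrow> f x = g x" "x \<in> U"
  shows "iter_deriv k f x y = iter_deriv k g x y"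
  using \<open>x \<in> U\<close>
proof (induction k arbitrary: x)
  case (Suc k)
  show ?case unfolding iter_deriv.simps dir_deriv_def
    by (intro Lim_cong[OF _ refl] dir_quot_cong_eventually[OF assms(1)] Suc)
qed (use assms in auto)

text \<open>Chart representatives contain \<open>inv_into\<close>, which is arbitrary off the image
  of the chart, so they can be rewritten only on a set. Derivatives follow because that set is open
  and a difference quotient with small increment stays inside it.\<close>

lemma Cr_on_cong:
  assumes "open U" "\<And>x. x \<in> U \<Longrightarrow> f x = g x" and f: "Cr_on r U f"
  shows "Cr_on r U g"
  unfolding Cr_on_def
proof (intro conjI allI impI ballI)
  note eq = iter_deriv_cong[OF assms(1,2)]
  fix k x y assume "enat (Suc k) \<le> r" "x \<in> U"
  with f obtain l where "(dir_quot (\<lambda>z. iter_deriv k f z y) x (y k) \<longlongrightarrow> l) (at 0)"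
    unfolding Cr_on_def by blast
  then have "(dir_quot (\<lambda>z. iter_deriv k g z y) x (y k) \<longlongrightarrow> l) (at 0)"
    by (rule Lim_transform_eventually)
      (intro dir_quot_cong_eventually[OF \<open>open U\<close> _ \<open>x \<in> U\<close>] eq, assumption+)
  then show "\<exists>l. (dir_quot (\<lambda>z. iter_deriv k g z y) x (y k) \<longlongrightarrow> l) (at 0)" by blast
next
  note eq = iter_deriv_cong[OF assms(1,2)]
  fix k assume "enat k \<le> r"
  with f have "continuous_on (U \<times> UNIV) (\<lambda>(x, y). iter_deriv k f x y)"
    unfolding Cr_on_def by blast
  then show "continuous_on (U \<times> UNIV) (\<lambda>(x, y). iter_deriv k g x y)"
    by (rule continuous_on_eq) (auto intro: eq)
qed

lemma Cr_on_local:
  assumes "\<And>x. x \<in> U \<Longrightarrow> \<exists>V. open V \<and> x \<in> V \<and> Cr_on r V f"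
  shows "Cr_on r U f"
  unfolding Cr_on_def
proof (intro conjI allI impI ballI)
  fix k x y assume "enat (Suc k) \<le> r" "x \<in> U"
  with assms obtain V where "x \<in> V" "Cr_on r V f" by blast
  with \<open>enat (Suc k) \<le> r\<close> show "\<exists>l. (dir_quot (\<lambda>z. iter_deriv k f z y) x (y k) \<longlongrightarrow> l) (at 0)"
    unfolding Cr_on_def by blast
next
  fix k assume k: "enat k \<le> r"
  have "continuous_on (\<Union>V\<in>{V. open V \<and> Cr_on r V f}. V \<times> UNIV) (\<lambda>(x, y). iter_deriv k f x y)"
    using k by (intro continuous_on_open_UN) (auto simp: Cr_on_def intro: open_Times)
  then show "continuous_on (U \<times> UNIV) (\<lambda>(x, y). iter_deriv k f x y)"
    by (rule continuous_on_subset) (use assms in blast)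
qed

text \<open>Since \<open>dir_deriv\<close> is a \<open>Lim\<close>, the formula of order
  \<open>k + 1\<close> can only be obtained together with the existence of the limits in both
  components; hence the restriction to orders up to \<open>r\<close> and the two joint
  conclusions.\<close>

lemma iter_deriv_map_prod:
  assumes U: "open U" "open V" and f: "Cr_on r U f" and g: "Cr_on r V g" and "enat k \<le> r"
    and "x \<in> U" "z \<in> V"
  shows "iter_deriv k (map_prod f g) (x, z) y = (iter_deriv k f x (fst \<circ> y), iter_deriv k g z (snd \<circ> y))"
    and "enat (Suc k) \<le> r \<Longrightarrow> \<exists>l. (dir_quot (\<lambda>p. iter_deriv k (map_prod f g) p y) (x, z) (y k) \<longlongrightarrow> l) (at 0)"
proof -
  define F where "F = (\<lambda>k x. iter_deriv k f x (fst \<circ> y))"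
  define G where "G = (\<lambda>k x. iter_deriv k g x (snd \<circ> y))"
  \<comment> \<open>The formula of order \<open>k\<close> is a premise here, so that this limit
    serves both inside the induction on \<open>k\<close> and, after it, for the second
    conclusion.\<close>
  have lim: "(dir_quot (\<lambda>p. iter_deriv k (map_prod f g) p y) (x, z) (y k) \<longlongrightarrow> (F (Suc k) x, G (Suc k) z)) (at 0)"
    if "enat (Suc k) \<le> r" "x \<in> U" "z \<in> V" and IH: "\<And>x z. x \<in> U \<Longrightarrow> z \<in> V \<Longrightarrow> iter_deriv k (map_prod f g) (x, z) y = (F k x, G k z)"
    for k x z
  proof -
    have "(dir_quot (F k) x (fst (y k)) \<longlongrightarrow> F (Suc k) x) (at 0)"
      using Cr_on_dir_quot_tendsto[OF f that(1,2), of "fst \<circ> y"] by (simp add: F_def)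
    moreover have "(dir_quot (G k) z (snd (y k)) \<longlongrightarrow> G (Suc k) z) (at 0)"
      using Cr_on_dir_quot_tendsto[OF g that(1,3), of "snd \<circ> y"] by (simp add: G_def)
    ultimately have "((\<lambda>t. (dir_quot (F k) x (fst (y k)) t, dir_quot (G k) z (snd (y k)) t)) \<longlongrightarrow> (F (Suc k) x, G (Suc k) z)) (at 0)"
      by (rule tendsto_Pair)
    moreover have "dir_quot (map_prod (F k) (G k)) (x, z) (y k) = (\<lambda>t. (dir_quot (F k) x (fst (y k)) t, dir_quot (G k) z (snd (y k)) t))"
      by (auto simp: dir_quot_def scaleR_prod_def plus_prod_def minus_prod_def)
    ultimately have "(dir_quot (map_prod (F k) (G k)) (x, z) (y k) \<longlongrightarrow> (F (Suc k) x, G (Suc k) z)) (at 0)" by simp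
    then show ?thesis
      by (rule Lim_transform_eventually)
        (rule dir_quot_cong_eventually[of "U \<times> V"], use U that in \<open>auto intro: open_Times simp: IH\<close>)
  qed
  have eq: "enat k \<le> r \<Longrightarrow> x \<in> U \<Longrightarrow> z \<in> V \<Longrightarrow> iter_deriv k (map_prod f g) (x, z) y = (F k x, G k z)" for k x z
  proof (induction k arbitrary: x z)
    case 0
    then show ?case by (simp add: F_def G_def)
  next
    case (Suc k)
    have "enat k \<le> r" using Suc.prems(1) by (rule order_trans[rotated]) simp
    with Suc have "(dir_quot (\<lambda>p. iter_deriv k (map_prod f g) p y) (x, z) (y k) \<longlongrightarrow> (F (Suc k) x, G (Suc k) z)) (at 0)"
      by (intro lim) auto
    then show ?case using dir_deriv_eqI by fastforce
  qed
  show "iter_deriv k (map_prod f g) (x, z) y = (iter_deriv k f x (fst \<circ> y), iter_deriv k g z (snd \<circ> y))"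
    using eq assms by (simp add: F_def G_def)
  show "\<exists>l. (dir_quot (\<lambda>p. iter_deriv k (map_prod f g) p y) (x, z) (y k) \<longlongrightarrow> l) (at 0)" if "enat (Suc k) \<le> r"
    using lim[OF that] eq assms by blast
qed

text \<open>Meant for transition maps between product charts. All orders are covered because the
  multiplication of \<open>G\<close> lives on a smooth product and the action on a C^1
  product.\<close>

lemma Cr_on_map_prod:
  fixes f :: "'a::locally_convex_space \<Rightarrow> 'b::locally_convex_space"
    and g :: "'c::locally_convex_space \<Rightarrow> 'd::locally_convex_space"
  assumes U: "open U" "open V" and f: "Cr_on r U f" and g: "Cr_on r V g"
  shows "Cr_on r (U \<times> V) (map_prod f g)"
  unfolding Cr_on_def
proof (intro conjI allI impI ballI)
  fix k p y assume "enat (Suc k) \<le> r" "p \<in> U \<times> V"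
  moreover from this have "enat k \<le> r" using order_trans[of "enat k" "enat (Suc k)" r] by simp
  ultimately show "\<exists>l. (dir_quot (\<lambda>z. iter_deriv k (map_prod f g) z y) p (y k) \<longlongrightarrow> l) (at 0)"
    using iter_deriv_map_prod(2)[OF assms] by (cases p) auto
next
  fix k assume k: "enat k \<le> r"
  have coord: "continuous_on S (\<lambda>p::('a \<times> 'c) \<times> (nat \<Rightarrow> 'a \<times> 'c). snd p i)" for i S
    by (rule continuous_on_compose2[OF continuous_on_product_coordinates continuous_on_snd[OF continuous_on_id]]) auto
  have dirs: "continuous_on S (\<lambda>p::('a \<times> 'c) \<times> (nat \<Rightarrow> 'a \<times> 'c). fst \<circ> snd p)"
      "continuous_on S (\<lambda>p::('a \<times> 'c) \<times> (nat \<Rightarrow> 'a \<times> 'c). snd \<circ> snd p)" for S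
    unfolding comp_def
    by (intro continuous_on_coordinatewise_then_product continuous_on_fst continuous_on_snd coord)+
  have "continuous_on (U \<times> UNIV) (\<lambda>(x, y). iter_deriv k f x y)"
    using f k by (auto simp: Cr_on_def)
  then have 1: "continuous_on ((U \<times> V) \<times> UNIV) (\<lambda>p::('a \<times> 'c) \<times> (nat \<Rightarrow> 'a \<times> 'c). case (fst (fst p), fst \<circ> snd p) of (x, y) \<Rightarrow> iter_deriv k f x y)"
    by (rule continuous_on_compose2) (intro continuous_on_Pair continuous_on_fst continuous_on_snd continuous_on_id dirs, auto)
  have "continuous_on (V \<times> UNIV) (\<lambda>(x, y). iter_deriv k g x y)"
    using g k by (auto simp: Cr_on_def)
  then have 2: "continuous_on ((U \<times> V) \<times> UNIV) (\<lambda>p::('a \<times> 'c) \<times> (nat \<Rightarrow> 'a \<times> 'c). case (snd (fst p), snd \<circ> snd p) of (x, y) \<Rightarrow> iter_deriv k g x y)"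
    by (rule continuous_on_compose2) (intro continuous_on_Pair continuous_on_fst continuous_on_snd continuous_on_id dirs, auto)
  show "continuous_on ((U \<times> V) \<times> UNIV) (\<lambda>(x, y). iter_deriv k (map_prod f g) x y)"
    by (rule continuous_on_eq[OF continuous_on_Pair[OF 1 2]])
      (use iter_deriv_map_prod(1)[OF assms k] in auto)
qed

section \<open>Charts and products of manifolds\<close>

lemma is_chartD:
  assumes "is_chart X (U, \<phi>)"
  shows "openin X U" "inj_on \<phi> U" "homeomorphic_map (subtopology X U) (top_of_set (\<phi> ` U)) \<phi>"
    "topspace (subtopology X U) = U"
proof -
  show *: "openin X U" "homeomorphic_map (subtopology X U) (top_of_set (\<phi> ` U)) \<phi>"
    using assms by (auto simp: is_chart_def)
  then show "topspace (subtopology X U) = U" using openin_subset by fastforce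
  then show "inj_on \<phi> U" using * by (metis homeomorphic_imp_injective_map)
qed

lemma chart_image_open:
  assumes c: "is_chart X (U, \<phi>)" and W: "openin X W" "W \<subseteq> U"
  shows "open (\<phi> ` W)"
proof -
  have "openin (subtopology X U) W" using W by (simp add: openin_open_subtopology is_chartD(1)[OF c])
  then have "openin (top_of_set (\<phi> ` U)) (\<phi> ` W)"
    using homeomorphic_imp_open_map[OF is_chartD(3)[OF c]] by (simp add: open_map_def)
  then show ?thesis using c by (auto simp: is_chart_def intro: openin_open_trans)
qed

lemma map_prod_image_Times: "map_prod f g ` (A \<times> B) = f ` A \<times> g ` B"
  by force

lemma is_chart_prod:
  assumes a: "is_chart X (U, \<phi>)" and b: "is_chart Y (V, \<psi>)"
  shows "is_chart (prod_topology X Y) (U \<times> V, map_prod \<phi> \<psi>)"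
proof -
  obtain \<phi>' \<psi>' where
    "homeomorphic_maps (subtopology X U) (top_of_set (\<phi> ` U)) \<phi> \<phi>'"
    "homeomorphic_maps (subtopology Y V) (top_of_set (\<psi> ` V)) \<psi> \<psi>'"
    using is_chartD(3)[OF a] is_chartD(3)[OF b] by (auto simp: homeomorphic_map_maps)
  then have "homeomorphic_maps (prod_topology (subtopology X U) (subtopology Y V))
      (prod_topology (top_of_set (\<phi> ` U)) (top_of_set (\<psi> ` V)))
      (\<lambda>(x, y). (\<phi> x, \<psi> y)) (\<lambda>(x, y). (\<phi>' x, \<psi>' y))"
    by (simp add: homeomorphic_maps_prod del: prod_topology_subtopology_eu)
  then have "homeomorphic_map (subtopology (prod_topology X Y) (U \<times> V))
      (top_of_set (map_prod \<phi> \<psi> ` (U \<times> V))) (map_prod \<phi> \<psi>)"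
    unfolding map_prod_image_Times homeomorphic_map_maps subtopology_Times
    by (auto simp: map_prod_def simp flip: prod_topology_subtopology_eu)
  then show ?thesis
    using a b by (auto simp: is_chart_def openin_prod_Times_iff map_prod_image_Times intro: open_Times)
qed

lemma Cr_transition_prod:
  assumes a: "is_chart X (U, \<phi>)" and a': "is_chart X (U', \<phi>')"
    and b: "is_chart Y (V, \<psi>)" and b': "is_chart Y (V', \<psi>')"
    and "Cr_transition r (U, \<phi>) (U', \<phi>')" "Cr_transition r (V, \<psi>) (V', \<psi>')"
  shows "Cr_transition r (U \<times> V, map_prod \<phi> \<psi>) (U' \<times> V', map_prod \<phi>' \<psi>')"
proof -
  have op: "open (\<phi> ` (U \<inter> U'))" "open (\<psi> ` (V \<inter> V'))"
    using chart_image_open[OF a, of "U \<inter> U'"] chart_image_open[OF b, of "V \<inter> V'"]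
      is_chartD(1)[OF a] is_chartD(1)[OF a'] is_chartD(1)[OF b] is_chartD(1)[OF b'] by auto
  have "Cr_on r (\<phi> ` (U \<inter> U') \<times> \<psi> ` (V \<inter> V'))
     (map_prod (\<phi>' \<circ> inv_into U \<phi>) (\<psi>' \<circ> inv_into V \<psi>))"
    using assms(5,6) op by (intro Cr_on_map_prod) (auto simp: Cr_transition_def)
  moreover have inj: "inj_on (map_prod \<phi> \<psi>) (U \<times> V)"
    using is_chartD(2)[OF a] is_chartD(2)[OF b] by (rule map_prod_inj_on)
  have "map_prod (\<phi>' \<circ> inv_into U \<phi>) (\<psi>' \<circ> inv_into V \<psi>) z = (map_prod \<phi>' \<psi>' \<circ> inv_into (U \<times> V) (map_prod \<phi> \<psi>)) z"
    if "z \<in> \<phi> ` (U \<inter> U') \<times> \<psi> ` (V \<inter> V')" for z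
  proof -
    obtain u v where z: "z = map_prod \<phi> \<psi> (u, v)" and "u \<in> U" "v \<in> V" using \<open>z \<in> _\<close> by auto
    then show ?thesis
      unfolding z comp_def by (subst inv_into_f_f[OF inj])
        (simp_all add: inv_into_f_f is_chartD(2)[OF a] is_chartD(2)[OF b])
  qed
  ultimately show ?thesis
    using op unfolding Cr_transition_def
    by (auto simp: Times_Int_Times map_prod_image_Times intro: Cr_on_cong[rotated 2] open_Times)
qed

lemma Cr_compatible_le: "Cr_compatible r a b \<Longrightarrow> s \<le> r \<Longrightarrow> Cr_compatible s a b"
  by (cases a; cases b) (auto simp: Cr_compatible_def Cr_transition_def intro: Cr_on_le)

lemma Cr_atlas_le: "Cr_atlas r X A \<Longrightarrow> s \<le> r \<Longrightarrow> Cr_atlas s X A"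
  unfolding Cr_atlas_def by (intro conjI ballI; elim conjE) (simp_all add: Cr_compatible_le[of r])

lemma Cr_atlas_chart: "Cr_atlas r X A \<Longrightarrow> a \<in> A \<Longrightarrow> is_chart X a"
  by (simp add: Cr_atlas_def)

lemma Cr_atlas_cover:
  assumes "Cr_atlas r X A" "p \<in> topspace X"
  obtains U \<phi> where "(U, \<phi>) \<in> A" "p \<in> U"
proof -
  have "p \<in> \<Union>(fst ` A)" using assms unfolding Cr_atlas_def by simp
  then obtain a where "a \<in> A" "p \<in> fst a" by blast
  then show ?thesis using that[of "fst a" "snd a"] by simp
qed

text \<open>The atlas of a product consists of the charts compatible with all product charts. That
  the product charts themselves belong to it is the compatibility of products of compatible
  charts.\<close>

lemma prod_manifold_chartI:
  assumes M: "Cr_atlas r (mtop M) (charts M)" and N: "Cr_atlas r (mtop N) (charts N)"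
    and "(U, \<phi>) \<in> charts M" "(V, \<psi>) \<in> charts N"
  shows "(U \<times> V, map_prod \<phi> \<psi>) \<in> charts (prod_manifold r M N)"
proof -
  have "Cr_compatible r a (U \<times> V, map_prod \<phi> \<psi>)"
    if "a \<in> {(U \<times> V, map_prod \<phi> \<psi>) | U \<phi> V \<psi>. (U, \<phi>) \<in> charts M \<and> (V, \<psi>) \<in> charts N}" for a
  proof -
    from that obtain U' \<phi>' V' \<psi>' where a: "a = (U' \<times> V', map_prod \<phi>' \<psi>')"
      and "(U', \<phi>') \<in> charts M" "(V', \<psi>') \<in> charts N" by blast
    with assms show ?thesis unfolding a Cr_compatible_def
      by (intro conjI Cr_transition_prod[where X="mtop M" and Y="mtop N"])
        (auto simp: Cr_atlas_def Cr_compatible_def)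
  qed
  moreover have "is_chart (prod_topology (mtop M) (mtop N)) (U \<times> V, map_prod \<phi> \<psi>)"
    using assms by (intro is_chart_prod) (auto dest: Cr_atlas_chart)
  ultimately show ?thesis
    by (simp add: prod_manifold_def Let_def maximal_atlas_def)
qed

lemma prod_manifold_is_chart: "a \<in> charts (prod_manifold r M N) \<Longrightarrow> is_chart (mtop (prod_manifold r M N)) a"
  by (simp add: prod_manifold_def Let_def maximal_atlas_def)

lemma mtop_prod_manifold [simp]: "mtop (prod_manifold r M N) = prod_topology (mtop M) (mtop N)"
  by (simp add: prod_manifold_def Let_def)

lemma mtop_lcs_manifold [simp]: "mtop (lcs_manifold r) = euclidean"
  by (simp add: lcs_manifold_def)

lemma id_in_charts: "(UNIV, id) \<in> charts (lcs_manifold 1)"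
proof -
  have "Cr_on 1 UNIV (id :: 'a \<Rightarrow> 'a)"
    using C1_on_affine[OF linear_id, of UNIV 0] by (simp add: id_def)
  then show ?thesis
    by (simp add: lcs_manifold_def maximal_atlas_def is_chart_def Cr_compatible_def Cr_transition_def
        homeomorphic_map_id subtopology_UNIV flip: id_def)
qed

lemma Cr_map_on_rep:
  assumes f: "Cr_map_on r M N W f" and a: "(U, \<phi>) \<in> charts M" "is_chart (mtop M) (U, \<phi>)"
    and b: "(V, \<psi>) \<in> charts N" "is_chart (mtop N) (V, \<psi>)"
  shows "openin (mtop M) {p \<in> W \<inter> U. f p \<in> V}"
    and "open (\<phi> ` {p \<in> W \<inter> U. f p \<in> V})"
    and "Cr_on r (\<phi> ` {p \<in> W \<inter> U. f p \<in> V}) (\<psi> \<circ> f \<circ> inv_into U \<phi>)"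
proof -
  have W: "openin (mtop M) W" and "continuous_map (subtopology (mtop M) W) (mtop N) f"
    using f by (auto simp: Cr_map_on_def)
  then have "openin (subtopology (mtop M) W) {p \<in> topspace (subtopology (mtop M) W). f p \<in> V}"
    by (intro openin_continuous_map_preimage[OF _ is_chartD(1)[OF b(2)]])
  moreover have "topspace (subtopology (mtop M) W) = W"
    using openin_subset[OF W] by auto
  ultimately have "openin (mtop M) {p \<in> W. f p \<in> V}"
    using W by (metis openin_trans_full)
  then have "openin (mtop M) ({p \<in> W. f p \<in> V} \<inter> U)"
    using is_chartD(1)[OF a(2)] by (rule openin_Int)
  also have "{p \<in> W. f p \<in> V} \<inter> U = {p \<in> W \<inter> U. f p \<in> V}" by auto
  finally show *: "openin (mtop M) {p \<in> W \<inter> U. f p \<in> V}" .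
  then show "open (\<phi> ` {p \<in> W \<inter> U. f p \<in> V})"
    by (rule chart_image_open[OF a(2)]) auto
  show "Cr_on r (\<phi> ` {p \<in> W \<inter> U. f p \<in> V}) (\<psi> \<circ> f \<circ> inv_into U \<phi>)"
    using f a(1) b(1) by (auto simp: Cr_map_on_def)
qed

section \<open>Curves and their velocities\<close>

text \<open>The coordinate vector of a tangent vector, in the space where sums and differences make
  sense. As a relation it also asserts that the limit exists, and it looks at time 0 only, so it
  passes through composites without a proof that they are C^1 curves.\<close>

definition chart_velocity ::
  "('m, 'e::locally_convex_space) chart \<Rightarrow> (real \<Rightarrow> 'm) \<Rightarrow> 'e \<Rightarrow> bool" where
  "chart_velocity a c l \<longleftrightarrow> (\<forall>\<^sub>F t in nhds 0. c t \<in> fst a) \<and> (dir_quot (snd a \<circ> c) 0 1 \<longlongrightarrow> l) (at 0)"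

text \<open>A local test in one chart of choice, easy to verify for lifts and composites;
  \<open>Cr_map_on_curveI\<close> upgrades it to the condition in all charts.\<close>

definition C1_curve_at :: "('m, 'e::locally_convex_space) mfd \<Rightarrow> (real \<Rightarrow> 'm) \<Rightarrow> real \<Rightarrow> bool" where
  "C1_curve_at M c t \<longleftrightarrow> (\<exists>(U, \<phi>) \<in> charts M. \<exists>T. open T \<and> t \<in> T \<and> c ` T \<subseteq> U \<and> Cr_on 1 T (\<phi> \<circ> c))"

lemma chart_velocity_unique:
  "chart_velocity (U, \<phi>) c l \<Longrightarrow> dir_deriv (\<phi> \<circ> c) 0 1 = l"
  by (simp add: chart_velocity_def dir_deriv_eqI)

lemma chart_velocity_inj: "chart_velocity a c l \<Longrightarrow> chart_velocity a c l' \<Longrightarrow> l = l'"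
  unfolding chart_velocity_def using tendsto_unique[OF trivial_limit_at] by blast

lemma dir_quot_real_cong:
  fixes c d :: "real \<Rightarrow> 'a::locally_convex_space"
  assumes "\<forall>\<^sub>F t in nhds 0. c t = d t" "(dir_quot c 0 1 \<longlongrightarrow> l) (at 0)"
  shows "(dir_quot d 0 1 \<longlongrightarrow> l) (at 0)"
proof (rule Lim_transform_eventually[OF assms(2)])
  have "\<forall>\<^sub>F t in at 0. c t = d t"
    using assms(1) by (auto simp: eventually_at_filter elim: eventually_mono)
  then show "\<forall>\<^sub>F t in at 0. dir_quot c 0 1 t = dir_quot d 0 1 t"
    by eventually_elim (simp add: dir_quot_def eventually_nhds_x_imp_x[OF assms(1)])
qed

lemma chart_velocity_cong:
  assumes eq: "\<forall>\<^sub>F t in nhds 0. c t = d t" and c: "chart_velocity a c l"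
  shows "chart_velocity a d l"
  unfolding chart_velocity_def
proof
  from c have "\<forall>\<^sub>F t in nhds 0. c t \<in> fst a" by (simp add: chart_velocity_def)
  with eq show "\<forall>\<^sub>F t in nhds 0. d t \<in> fst a" by eventually_elim simp
  from eq have "\<forall>\<^sub>F t in nhds 0. (snd a \<circ> c) t = (snd a \<circ> d) t" by eventually_elim simp
  then show "(dir_quot (snd a \<circ> d) 0 1 \<longlongrightarrow> l) (at 0)"
    using c unfolding chart_velocity_def by (blast intro: dir_quot_real_cong)
qed

lemma dir_quot_tendsto_imp_continuous:
  fixes c :: "real \<Rightarrow> 'a::locally_convex_space"
  assumes "(dir_quot c 0 1 \<longlongrightarrow> l) (at 0)"
  shows "(c \<longlongrightarrow> c 0) (nhds 0)"
proof -
  have "((\<lambda>t. c 0 + t *\<^sub>R dir_quot c 0 1 t) \<longlongrightarrow> c 0 + 0 *\<^sub>R l) (at 0)"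
    by (intro tendsto_add tendsto_const tendsto_scaleR_lcs tendsto_ident_at assms)
  moreover have "\<forall>\<^sub>F t in at 0. c 0 + t *\<^sub>R dir_quot c 0 1 t = c t"
    by (simp add: eventually_at_filter dir_quot_def)
  ultimately have "(c \<longlongrightarrow> c 0) (at 0)"
    using Lim_transform_eventually by fastforce
  then show ?thesis
    by (simp add: tendsto_nhds_iff)
qed

text \<open>\<open>D\<close> is the derivative of the chart representative of \<open>f\<close> at
  \<open>\<phi> p\<close>. It is chosen before the curve, so velocities of different curves through
  \<open>p\<close> are compared by one and the same additive map. That the curve stays where the
  representative is defined follows from continuity at 0, a consequence of the existence of its
  velocity.\<close>

lemma Cr_map_on_tangent:
  fixes f :: "'m \<Rightarrow> 'n" and M :: "('m, 'e::locally_convex_space) mfd" and N :: "('n, 'f::locally_convex_space) mfd"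
  assumes f: "Cr_map_on 1 M N W f"
    and a: "(U, \<phi>) \<in> charts M" "is_chart (mtop M) (U, \<phi>)"
    and b: "(V, \<psi>) \<in> charts N" "is_chart (mtop N) (V, \<psi>)"
    and p: "p \<in> W" "p \<in> U" "f p \<in> V"
  obtains D :: "'e \<Rightarrow> 'f" where "\<And>u v. D (u + v) = D u + D v"
    and "\<And>c l. c 0 = p \<Longrightarrow> chart_velocity (U, \<phi>) c l \<Longrightarrow> chart_velocity (V, \<psi>) (f \<circ> c) (D l)"
proof -
  define B where "B = \<phi> ` {p \<in> W \<inter> U. f p \<in> V}"
  define F where "F = \<psi> \<circ> f \<circ> inv_into U \<phi>"
  have B: "open B" "Cr_on 1 B F" "\<phi> p \<in> B"
    using Cr_map_on_rep[OF f a b] p by (auto simp: B_def F_def)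
  note inj = is_chartD(2)[OF a(2)]
  show ?thesis
  proof (rule that[of "dir_deriv F (\<phi> p)"])
    show "dir_deriv F (\<phi> p) (u + v) = dir_deriv F (\<phi> p) u + dir_deriv F (\<phi> p) v" for u v
      by (rule dir_deriv_add[OF B(2,1,3)])
    fix c l assume c: "c 0 = p" "chart_velocity (U, \<phi>) c l"
    then have lim: "(dir_quot (\<phi> \<circ> c) 0 1 \<longlongrightarrow> l) (at 0)" and U: "\<forall>\<^sub>F t in nhds 0. c t \<in> U"
      by (auto simp: chart_velocity_def)
    have "\<forall>\<^sub>F t in nhds 0. (\<phi> \<circ> c) t \<in> B"
      by (rule topological_tendstoD[OF dir_quot_tendsto_imp_continuous[OF lim] B(1)]) (simp add: B(3) c(1))
    with U have ev: "\<forall>\<^sub>F t in nhds 0. f (c t) \<in> V \<and> (F \<circ> (\<phi> \<circ> c)) t = (\<psi> \<circ> (f \<circ> c)) t"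
    proof eventually_elim
      case (elim t)
      then have "c t \<in> {p \<in> W \<inter> U. f p \<in> V}"
        using inj unfolding B_def by (auto dest: inj_onD)
      then show ?case using inv_into_f_f[OF inj] by (auto simp: F_def)
    qed
    have "(dir_quot (F \<circ> (\<phi> \<circ> c)) 0 1 \<longlongrightarrow> dir_deriv F (\<phi> p) l) (at 0)"
      using dir_quot_chain[OF B(2,1) _ lim] B(3) c(1) by simp
    then have "(dir_quot (\<psi> \<circ> (f \<circ> c)) 0 1 \<longlongrightarrow> dir_deriv F (\<phi> p) l) (at 0)"
      by (rule dir_quot_real_cong[rotated]) (use ev in \<open>auto elim: eventually_mono\<close>)
    with ev show "chart_velocity (V, \<psi>) (f \<circ> c) (dir_deriv F (\<phi> p) l)"
      by (auto simp: chart_velocity_def elim: eventually_mono)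
  qed
qed

lemma Cr_map_on_curve_rep:
  assumes "Cr_map_on 1 (lcs_manifold 1) M I c" and "(U, \<phi>) \<in> charts M" "is_chart (mtop M) (U, \<phi>)"
  shows "open {t \<in> I. c t \<in> U}" "Cr_on 1 {t \<in> I. c t \<in> U} (\<phi> \<circ> c)"
  using Cr_map_on_rep[OF assms(1) id_in_charts _ assms(2,3)] id_in_charts
  by (simp_all add: is_chart_def homeomorphic_map_id)

lemma C1_curve_velocity:
  assumes c: "C1_curve M p c" and a: "(U, \<phi>) \<in> charts M" "is_chart (mtop M) (U, \<phi>)" "p \<in> U"
  shows "chart_velocity (U, \<phi>) c (dir_deriv (\<phi> \<circ> c) 0 1)"
proof -
  from c obtain e where e: "e > 0" "c 0 = p" "Cr_map_on 1 (lcs_manifold 1) M {-e<..<e} c"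
    by (auto simp: C1_curve_def)
  note rep = Cr_map_on_curve_rep[OF e(3) a(1,2)]
  have 0: "0 \<in> {t \<in> {-e<..<e}. c t \<in> U}" using e a by auto
  then have "\<forall>\<^sub>F t in nhds 0. t \<in> {t \<in> {-e<..<e}. c t \<in> U}"
    using rep(1) by (intro eventually_nhds_in_open)
  then show ?thesis
    using C1_dir_quot_tendsto[OF rep(2) 0] by (auto simp: chart_velocity_def elim: eventually_mono)
qed

text \<open>Of the atlas of \<open>M\<close> only charthood is asked, which membership in the
  maximal atlas of a product supplies directly.\<close>

lemma C1_curve_at_compose:
  assumes f: "Cr_map_on 1 M N (mcarrier M) f" and c: "C1_curve_at M c t"
    and M: "\<And>a. a \<in> charts M \<Longrightarrow> is_chart (mtop M) a"
    and N: "Cr_atlas r (mtop N) (charts N)"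
  shows "C1_curve_at N (f \<circ> c) t"
proof -
  from c obtain U \<phi> T where T: "(U, \<phi>) \<in> charts M" "open T" "t \<in> T" "c ` T \<subseteq> U" "Cr_on 1 T (\<phi> \<circ> c)"
    by (auto simp: C1_curve_at_def)
  note a = T(1) M[OF T(1)]
  have U: "U \<subseteq> mcarrier M" using is_chartD(1)[OF a(2)] by (rule openin_subset)
  have "f (c t) \<in> mcarrier N"
    using f T(3,4) U by (auto simp: Cr_map_on_def continuous_map_def)
  then obtain V \<psi> where b: "(V, \<psi>) \<in> charts N" "f (c t) \<in> V"
    using Cr_atlas_cover[OF N] by metis
  note rep = Cr_map_on_rep[OF f a b(1) Cr_atlas_chart[OF N b(1)]]
  define B where "B = \<phi> ` {p \<in> mcarrier M \<inter> U. f p \<in> V}"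
  define S where "S = T \<inter> (\<phi> \<circ> c) -` B"
  have "open S"
    unfolding S_def B_def by (rule continuous_open_preimage[OF Cr_on_continuous[OF T(5)] T(2) rep(2)])
  moreover have "t \<in> S" using T(3,4) U b(2) by (auto simp: S_def B_def)
  moreover have S: "f (c s) \<in> V" "(\<psi> \<circ> f \<circ> inv_into U \<phi> \<circ> (\<phi> \<circ> c)) s = (\<psi> \<circ> (f \<circ> c)) s" if "s \<in> S" for s
  proof -
    have "c s \<in> U" using that T(4) by (auto simp: S_def)
    moreover from this have "c s \<in> {p \<in> mcarrier M \<inter> U. f p \<in> V}"
      using that inj_on_image_mem_iff[OF is_chartD(2)[OF a(2)], of "c s" "{p \<in> mcarrier M \<inter> U. f p \<in> V}"]
      by (auto simp: S_def B_def)
    ultimately show "f (c s) \<in> V" "(\<psi> \<circ> f \<circ> inv_into U \<phi> \<circ> (\<phi> \<circ> c)) s = (\<psi> \<circ> (f \<circ> c)) s"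
      using is_chartD(2)[OF a(2)] by auto
  qed
  moreover have "Cr_on 1 S (\<psi> \<circ> f \<circ> inv_into U \<phi> \<circ> (\<phi> \<circ> c))"
    using rep(2,3) unfolding B_def[symmetric]
    by (intro C1_on_compose[OF Cr_on_mono[OF T(5)]]) (auto simp: S_def)
  then have "Cr_on 1 S (\<psi> \<circ> (f \<circ> c))"
    by (rule Cr_on_cong[OF \<open>open S\<close>, rotated]) (rule S(2))
  ultimately show ?thesis
    unfolding C1_curve_at_def using b(1) by (intro bexI[of _ "(V, \<psi>)"]) (auto intro!: exI[of _ S])
qed

lemma Cr_on_1_const: "Cr_on 1 T (\<lambda>_. a)"
  using C1_on_affine[OF linear_zero, of T a] by simp

lemma C1_curve_at_Pair_const:
  assumes c: "C1_curve_at M c t" and y: "y \<in> mcarrier N"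
    and M: "Cr_atlas r (mtop M) (charts M)" and N: "Cr_atlas r (mtop N) (charts N)"
  shows "C1_curve_at (prod_manifold r M N) (\<lambda>s. (c s, y)) t"
proof -
  from c obtain U \<phi> T where T: "(U, \<phi>) \<in> charts M" "open T" "t \<in> T" "c ` T \<subseteq> U" "Cr_on 1 T (\<phi> \<circ> c)"
    by (auto simp: C1_curve_at_def)
  obtain V \<psi> where V: "(V, \<psi>) \<in> charts N" "y \<in> V"
    using Cr_atlas_cover[OF N y] .
  have "map_prod \<phi> \<psi> \<circ> (\<lambda>s. (c s, y)) = (\<lambda>s. ((\<phi> \<circ> c) s, \<psi> y))" by auto
  then have "Cr_on 1 T (map_prod \<phi> \<psi> \<circ> (\<lambda>s. (c s, y)))"
    using C1_on_Pair[OF T(5) Cr_on_1_const] by metis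
  then show ?thesis
    unfolding C1_curve_at_def using prod_manifold_chartI[OF M N T(1) V(1)] T(2,3,4) V(2)
    by (intro bexI[of _ "(U \<times> V, map_prod \<phi> \<psi>)"]) (auto intro!: exI[of _ T])
qed

lemma chart_velocity_Pair:
  assumes "chart_velocity (U, \<phi>) c l" "y \<in> V"
  shows "chart_velocity (U \<times> V, map_prod \<phi> \<psi>) (\<lambda>t. (c t, y)) (l, 0)"
    and "chart_velocity (V \<times> U, map_prod \<psi> \<phi>) (\<lambda>t. (y, c t)) (0, l)"
proof -
  have "dir_quot (map_prod \<phi> \<psi> \<circ> (\<lambda>t. (c t, y))) 0 1 = (\<lambda>t. (dir_quot (\<phi> \<circ> c) 0 1 t, 0))"
     "dir_quot (map_prod \<psi> \<phi> \<circ> (\<lambda>t. (y, c t))) 0 1 = (\<lambda>t. (0, dir_quot (\<phi> \<circ> c) 0 1 t))"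
    by (auto simp: dir_quot_def scaleR_prod_def)
  with assms show "chart_velocity (U \<times> V, map_prod \<phi> \<psi>) (\<lambda>t. (c t, y)) (l, 0)"
    "chart_velocity (V \<times> U, map_prod \<psi> \<phi>) (\<lambda>t. (y, c t)) (0, l)"
    by (auto simp: chart_velocity_def intro: tendsto_Pair)
qed

text \<open>In arbitrary charts the curve is locally a transition map of \<open>N\<close>, after a
  representative known to be C^1, after the inverse of a chart of the line. Continuity into
  \<open>N\<close> is likewise read off in the chosen charts.\<close>

lemma Cr_map_on_curveI:
  fixes N :: "('n, 'f::locally_convex_space) mfd"
  assumes N: "Cr_atlas 1 (mtop N) (charts N)" and W: "open W"
    and c: "\<And>t. t \<in> W \<Longrightarrow> C1_curve_at N c t"
  shows "Cr_map_on 1 (lcs_manifold 1) N W c"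
proof -
  have op: "open {t \<in> W. c t \<in> X}" if X: "openin (mtop N) X" for X
  proof (subst open_subopen, intro ballI)
    fix t assume t: "t \<in> {t \<in> W. c t \<in> X}"
    then obtain V \<psi> T where T: "(V, \<psi>) \<in> charts N" "open T" "t \<in> T" "c ` T \<subseteq> V" "Cr_on 1 T (\<psi> \<circ> c)"
      using c[of t] by (auto simp: C1_curve_at_def)
    note chart = Cr_atlas_chart[OF N T(1)]
    have "open (\<psi> ` (V \<inter> X))"
      using is_chartD(1)[OF chart] X by (intro chart_image_open[OF chart]) auto
    then have "open (T \<inter> (\<psi> \<circ> c) -` (\<psi> ` (V \<inter> X)))"
      by (rule continuous_open_preimage[OF Cr_on_continuous[OF T(5)] T(2)])
    moreover have "t \<in> T \<inter> (\<psi> \<circ> c) -` (\<psi> ` (V \<inter> X))" using t T by auto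
    moreover have "T \<inter> (\<psi> \<circ> c) -` (\<psi> ` (V \<inter> X)) \<subseteq> {t. c t \<in> X}"
    proof
      fix s assume "s \<in> T \<inter> (\<psi> \<circ> c) -` (\<psi> ` (V \<inter> X))"
      then have "c s \<in> V" "\<psi> (c s) \<in> \<psi> ` (V \<inter> X)" using T(4) by auto
      then show "s \<in> {t. c t \<in> X}"
        using inj_on_image_mem_iff[OF is_chartD(2)[OF chart] _ Int_lower1, of "c s" X] by simp
    qed
    ultimately show "\<exists>S. open S \<and> t \<in> S \<and> S \<subseteq> {t \<in> W. c t \<in> X}"
      using W t by (intro exI[of _ "(T \<inter> (\<psi> \<circ> c) -` (\<psi> ` (V \<inter> X))) \<inter> W"]) (auto intro: open_Int)
  qed
  have carrier: "c t \<in> mcarrier N" if t: "t \<in> W" for t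
  proof -
    from c[OF t] obtain V \<psi> where "(V, \<psi>) \<in> charts N" "c t \<in> V" by (auto simp: C1_curve_at_def)
    then show ?thesis using openin_subset[OF is_chartD(1)[OF Cr_atlas_chart[OF N]]] by auto
  qed
  have "continuous_map (top_of_set W) (mtop N) c"
    unfolding continuous_map_def
  proof (intro conjI allI impI)
    show "c \<in> topspace (top_of_set W) \<rightarrow> mcarrier N" using carrier by auto
    fix X assume "openin (mtop N) X"
    then show "openin (top_of_set W) {t \<in> topspace (top_of_set W). c t \<in> X}"
      using op by (auto intro!: open_subset)
  qed
  moreover have "Cr_on 1 (\<phi> ` {t \<in> W \<inter> U. c t \<in> V}) (\<psi> \<circ> c \<circ> inv_into U \<phi>)"
    if a: "(U, \<phi>) \<in> charts (lcs_manifold 1 :: (real, real) mfd)" and b: "(V, \<psi>) \<in> charts N" for U \<phi> V \<psi>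
  proof (rule Cr_on_local)
    fix x assume "x \<in> \<phi> ` {t \<in> W \<inter> U. c t \<in> V}"
    then obtain t where t: "x = \<phi> t" "t \<in> W" "t \<in> U" "c t \<in> V" by blast
    obtain V' \<psi>' T where T: "(V', \<psi>') \<in> charts N" "open T" "t \<in> T" "c ` T \<subseteq> V'" "Cr_on 1 T (\<psi>' \<circ> c)"
      using c[OF t(2)] by (auto simp: C1_curve_at_def)
    have U: "is_chart euclidean (U, \<phi>)" and "Cr_compatible 1 (UNIV, id) (U, \<phi>)"
      using a by (auto simp: lcs_manifold_def maximal_atlas_def)
    \<comment> \<open>\<open>\<phi>\<close> ranges over the whole maximal atlas of the line;
      compatibility with the identity chart is what makes its inverse C^1.\<close>
    then have trU: "Cr_on 1 (\<phi> ` U) (inv_into U \<phi>)"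
      by (simp add: Cr_compatible_def Cr_transition_def)
    have trV: "Cr_on 1 (\<psi>' ` (V' \<inter> V)) (\<psi> \<circ> inv_into V' \<psi>')"
      using N T(1) b by (auto simp: Cr_atlas_def Cr_compatible_def Cr_transition_def)
    note chV = Cr_atlas_chart[OF N b] and chV' = Cr_atlas_chart[OF N T(1)]
    have opV: "open (\<psi>' ` (V' \<inter> V))"
      using is_chartD(1)[OF chV] is_chartD(1)[OF chV'] by (intro chart_image_open[OF chV']) auto
    define S where "S = T \<inter> {t \<in> W. c t \<in> V} \<inter> U"
    have S: "open S" "t \<in> S"
      using T t op[OF is_chartD(1)[OF chV]] is_chartD(1)[OF U] by (auto simp: S_def intro!: open_Int)
    have opS: "open (\<phi> ` S)"
      using S by (intro chart_image_open[OF U]) (auto simp: S_def)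
    have inv: "inv_into U \<phi> z \<in> S" if "z \<in> \<phi> ` S" for z
      using that is_chartD(2)[OF U] by (auto simp: S_def)
    have "Cr_on 1 (\<phi> ` S) ((\<psi>' \<circ> c) \<circ> inv_into U \<phi>)"
      using inv T(2) by (intro C1_on_compose[OF Cr_on_mono[OF trU] T(5)]) (auto simp: S_def)
    then have "Cr_on 1 (\<phi> ` S) ((\<psi> \<circ> inv_into V' \<psi>') \<circ> ((\<psi>' \<circ> c) \<circ> inv_into U \<phi>))"
      using inv T(4) by (intro C1_on_compose[OF _ trV opV]) (auto simp: S_def image_subset_iff)
    then have "Cr_on 1 (\<phi> ` S) (\<psi> \<circ> c \<circ> inv_into U \<phi>)"
    proof (rule Cr_on_cong[OF opS, rotated])
      fix z assume "z \<in> \<phi> ` S"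
      then have "c (inv_into U \<phi> z) \<in> V'" using inv[of z] T(4) by (auto simp: S_def)
      then show "((\<psi> \<circ> inv_into V' \<psi>') \<circ> ((\<psi>' \<circ> c) \<circ> inv_into U \<phi>)) z = (\<psi> \<circ> c \<circ> inv_into U \<phi>) z"
        using is_chartD(2)[OF chV'] by simp
    qed
    then show "\<exists>Z. open Z \<and> x \<in> Z \<and> Cr_on 1 Z (\<psi> \<circ> c \<circ> inv_into U \<phi>)"
      using opS S(2) t(1) by blast
  qed
  ultimately show ?thesis
    using W by (auto simp: Cr_map_on_def)
qed

lemma Cr_map_on_le: "Cr_map_on r M N W f \<Longrightarrow> s \<le> r \<Longrightarrow> Cr_map_on s M N W f"
  unfolding Cr_map_on_def case_prod_unfold by (meson Cr_on_le)

section \<open>The tangent relation and curves with prescribed velocity\<close>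

lemma tangent_rel_iff:
  "(c, d) \<in> tangent_rel M p \<longleftrightarrow> C1_curve M p c \<and> C1_curve M p d \<and>
    (\<forall>U \<phi>. (U, \<phi>) \<in> charts M \<longrightarrow> p \<in> U \<longrightarrow> dir_deriv (\<phi> \<circ> c) 0 1 = dir_deriv (\<phi> \<circ> d) 0 1)"
  by (auto simp: tangent_rel_def)

lemma equiv_tangent_rel: "equiv {c. C1_curve M p c} (tangent_rel M p)"
  by (rule equivI; (rule refl_onI symI transI subsetI)?) (auto simp: tangent_rel_iff)

lemma C1_curveI:
  assumes N: "Cr_atlas 1 (mtop N) (charts N)" and T: "open T" "0 \<in> T" and c: "\<And>t. t \<in> T \<Longrightarrow> C1_curve_at N c t"
  shows "C1_curve N (c 0) c"
proof -
  obtain e where e: "e > 0" "ball 0 e \<subseteq> T" using T open_contains_ball by blast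
  then have "Cr_map_on 1 (lcs_manifold 1) N {-e<..<e} c"
    using c by (intro Cr_map_on_curveI[OF N]) (auto simp: dist_real_def subset_eq)
  with e(1) show ?thesis by (auto simp: C1_curve_def)
qed

lemma C1_curve_at_cong:
  assumes c: "C1_curve_at M c t" and T: "open T" "t \<in> T" and eq: "\<And>s. s \<in> T \<Longrightarrow> c s = d s"
  shows "C1_curve_at M d t"
proof -
  from c obtain U \<phi> S where S: "(U, \<phi>) \<in> charts M" "open S" "t \<in> S" "c ` S \<subseteq> U" "Cr_on 1 S (\<phi> \<circ> c)"
    by (auto simp: C1_curve_at_def)
  have "Cr_on 1 (S \<inter> T) (\<phi> \<circ> d)"
    by (rule Cr_on_cong[OF open_Int[OF S(2) T(1)] _ Cr_on_mono[OF S(5)]]) (auto simp: eq)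
  moreover have "d ` (S \<inter> T) \<subseteq> U" using S(4) eq by force
  ultimately show ?thesis
    unfolding C1_curve_at_def using S(1,2,3) T
    by (intro bexI[of _ "(U, \<phi>)"]) (auto intro!: exI[of _ "S \<inter> T"])
qed

lemma chart_velocity_const: "p \<in> U \<Longrightarrow> chart_velocity (U, \<phi>) (\<lambda>_. p) 0"
proof -
  have "dir_quot (\<phi> \<circ> (\<lambda>_. p)) (0::real) 1 = (\<lambda>_. 0)" by (simp add: dir_quot_def fun_eq_iff)
  then show "p \<in> U \<Longrightarrow> chart_velocity (U, \<phi>) (\<lambda>_. p) 0" by (simp add: chart_velocity_def)
qed

text \<open>A straight line in the chart. It turns a coordinate vector into a class of curves, the
  form in which \<open>has_exponential\<close> accepts its argument.\<close>

lemma ex_curve_with_velocity: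
  fixes M :: "('m, 'e::locally_convex_space) mfd"
  assumes M: "Cr_atlas 1 (mtop M) (charts M)" and a: "(U, \<phi>) \<in> charts M" "p \<in> U"
  obtains c where "C1_curve M p c" "chart_velocity (U, \<phi>) c u"
proof -
  note chart = Cr_atlas_chart[OF M a(1)]
  define c where "c = (\<lambda>t. inv_into U \<phi> (\<phi> p + t *\<^sub>R u))"
  define T where "T = (\<lambda>t. \<phi> p + t *\<^sub>R u) -` (\<phi> ` U)"
  have cont: "continuous_on UNIV (\<lambda>t::real. t *\<^sub>R u)"
    unfolding continuous_on_def by (intro ballI tendsto_scaleR_lcs tendsto_ident_at tendsto_const)
  have "linear (\<lambda>t::real. t *\<^sub>R u)" by (simp add: linear_iff algebra_simps)
  note line = C1_on_affine[OF this cont]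
  have "open (\<phi> ` U)" using chart by (simp add: is_chart_def)
  then have T: "open T" "0 \<in> T"
    using a(2) open_vimage[OF _ Cr_on_continuous[OF line]] by (auto simp: T_def)
  have ct: "c t \<in> U" "\<phi> (c t) = \<phi> p + t *\<^sub>R u" if "t \<in> T" for t
    using that unfolding T_def c_def by (auto intro: inv_into_into f_inv_into_f)
  have "Cr_on 1 T (\<phi> \<circ> c)"
    by (rule Cr_on_cong[OF T(1) _ line]) (simp add: ct)
  then have "C1_curve_at M c t" if "t \<in> T" for t
    unfolding C1_curve_at_def using a(1) T(1) that ct(1)
    by (intro bexI[of _ "(U, \<phi>)"]) (auto intro!: exI[of _ T])
  then have "C1_curve M (c 0) c" by (rule C1_curveI[OF M T])
  moreover have "c 0 = p" using a(2) is_chartD(2)[OF chart] by (simp add: c_def)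
  moreover have "chart_velocity (U, \<phi>) c u"
    unfolding chart_velocity_def
  proof
    have ev: "\<forall>\<^sub>F t in nhds 0. t \<in> T" using T by (rule eventually_nhds_in_open)
    then show "\<forall>\<^sub>F t in nhds 0. c t \<in> fst (U, \<phi>)" by eventually_elim (simp add: ct)
    have "(dir_quot (\<lambda>t. \<phi> p + t *\<^sub>R u) 0 1 \<longlongrightarrow> u) (at 0)"
      by (rule Lim_transform_eventually[OF tendsto_const]) (simp add: eventually_at_filter dir_quot_def)
    moreover have "\<forall>\<^sub>F t in nhds 0. \<phi> p + t *\<^sub>R u = (snd (U, \<phi>) \<circ> c) t"
      using ev by eventually_elim (simp add: ct)
    ultimately show "(dir_quot (snd (U, \<phi>) \<circ> c) 0 1 \<longlongrightarrow> u) (at 0)"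
      by (rule dir_quot_real_cong[rotated])
  qed
  ultimately show ?thesis using that by simp
qed

lemma additive_diff:
  fixes D :: "'a::ab_group_add \<Rightarrow> 'b::ab_group_add"
  assumes "\<And>u v. D (u + v) = D u + D v"
  shows "D (u - v) = D u - D v" "D 0 = 0"
  using assms[of "u - v" v] assms[of 0 0] by simp_all

section \<open>Lie groups and homogeneous spaces\<close>

context lie_group
begin

lemma atlas: "Cr_atlas \<infinity> (mtop MG) (charts MG)" "Cr_atlas 1 (mtop MG) (charts MG)"
  using smooth_manifold Cr_atlas_le[of \<infinity>] by (auto simp: Cr_manifold_def)

text \<open>Smoothness is given for multiplication in both variables. Translation by
  \<open>g\<close> is reached through the curves \<open>(g, c t)\<close>, whose coordinate velocity
  is \<open>(0, l)\<close>.\<close>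

lemma left_mult_tangent:
  assumes g: "g \<in> carrier G" and U: "(U, \<phi>) \<in> charts MG" "h \<in> U"
    and V: "(V, \<psi>) \<in> charts MG" "g \<otimes> h \<in> V"
  obtains D where "\<And>u v. D (u + v) = D u + D v"
    and "\<And>c l. c 0 = h \<Longrightarrow> chart_velocity (U, \<phi>) c l \<Longrightarrow> chart_velocity (V, \<psi>) (\<lambda>t. g \<otimes> c t) (D l)"
proof -
  obtain X \<xi> where X: "(X, \<xi>) \<in> charts MG" "g \<in> X"
    using Cr_atlas_cover[OF atlas(1)] g carrier_eq by metis
  note a = prod_manifold_chartI[OF atlas(1) atlas(1) X(1) U(1)]
  have mult: "Cr_map_on 1 (prod_manifold \<infinity> MG MG) MG (mcarrier (prod_manifold \<infinity> MG MG)) (\<lambda>(g, h). g \<otimes> h)"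
    using smooth_mult by (rule Cr_map_on_le) simp
  have "h \<in> mcarrier MG"
    using U is_chartD(1)[OF Cr_atlas_chart[OF atlas(1) U(1)]] openin_subset by blast
  then have p: "(g, h) \<in> mcarrier (prod_manifold \<infinity> MG MG)" using g carrier_eq by simp
  obtain D where D: "\<And>u v. D (u + v) = D u + D v"
    "\<And>c l. c 0 = (g, h) \<Longrightarrow> chart_velocity (X \<times> U, map_prod \<xi> \<phi>) c l \<Longrightarrow> chart_velocity (V, \<psi>) ((\<lambda>(g, h). g \<otimes> h) \<circ> c) (D l)"
    using Cr_map_on_tangent[OF mult a prod_manifold_is_chart[OF a] V(1) Cr_atlas_chart[OF atlas(1) V(1)] p] X(2) U(2) V(2)
    by (metis (no_types, lifting) SigmaI case_prod_conv)
  show ?thesis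
  proof (rule that[of "\<lambda>l. D (0, l)"])
    show "D (0, u + v) = D (0, u) + D (0, v)" for u v
      using D(1)[of "(0, u)" "(0, v)"] by simp
    show "chart_velocity (V, \<psi>) (\<lambda>t. g \<otimes> c t) (D (0, l))" if "c 0 = h" "chart_velocity (U, \<phi>) c l" for c l
      using D(2)[OF _ chart_velocity_Pair(2)[OF that(2) X(2)]] that(1) by (simp add: comp_def)
  qed
qed

lemma one_parameter_group:
  assumes exp: "has_exponential G MG" and U: "(U, \<phi>) \<in> charts MG" "\<one> \<in> U"
  obtains \<gamma> where "\<gamma> 0 = \<one>" "\<And>s t. \<gamma> (s + t) = \<gamma> s \<otimes> \<gamma> t" "\<And>t. \<gamma> t \<in> carrier G"
    "chart_velocity (U, \<phi>) \<gamma> u"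
proof -
  obtain c where c: "C1_curve MG \<one> c" "chart_velocity (U, \<phi>) c u"
    using ex_curve_with_velocity[OF atlas(2) U] .
  have c0: "c 0 = \<one>" using c(1) by (simp add: C1_curve_def)
  have "velocity MG c \<in> tangent_space MG \<one>"
    unfolding velocity_def tangent_space_def c0 using c(1) by (intro quotientI) simp
  then obtain \<gamma> where \<gamma>: "Cr_map \<infinity> (lcs_manifold \<infinity> :: (real, real) mfd) MG \<gamma>"
      "\<And>s t. \<gamma> (s + t) = \<gamma> s \<otimes> \<gamma> t" "velocity MG \<gamma> = velocity MG c"
    using exp unfolding has_exponential_def by metis
  have "c \<in> velocity MG c"
    unfolding velocity_def c0 using c(1) by (simp add: tangent_rel_iff)
  \<comment> \<open>The class of \<open>\<gamma>\<close> is taken at the base point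
    \<open>\<gamma> 0\<close>, which is not yet known. Membership of \<open>c\<close> in it forces
    \<open>\<gamma> 0 = c 0\<close>, the identity.\<close>
  then have "c \<in> velocity MG \<gamma>" using \<gamma>(3) by simp
  then have rel: "(\<gamma>, c) \<in> tangent_rel MG (\<gamma> 0)" by (simp add: velocity_def)
  then have \<gamma>0: "\<gamma> 0 = \<one>" using c0 by (simp add: tangent_rel_iff C1_curve_def)
  have "\<gamma> t \<in> carrier G" for t
    using \<gamma>(1) carrier_eq by (auto simp: Cr_map_on_def continuous_map_def Pi_iff)
  moreover have "chart_velocity (U, \<phi>) \<gamma> u"
  proof -
    have "C1_curve MG \<one> \<gamma>" and "dir_deriv (\<phi> \<circ> \<gamma>) 0 1 = dir_deriv (\<phi> \<circ> c) 0 1"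
      using rel U \<gamma>0 by (auto simp: tangent_rel_iff)
    then show ?thesis
      using C1_curve_velocity[OF _ U(1) Cr_atlas_chart[OF atlas(1) U(1)] U(2)] chart_velocity_unique[OF c(2)] by metis
  qed
  ultimately show ?thesis using that \<gamma>0 \<gamma>(2) by blast
qed

end

section \<open>The orbit map and its factorisation through the cosets\<close>

locale smooth_homogeneous_space = lie_group G MG + C1_action G MG M \<sigma>
  for G :: "('g, 'b) monoid_scheme" (structure)
    and MG :: "('g, 'e::locally_convex_space) mfd"
    and M :: "('m, 'f::locally_convex_space) mfd"
    and \<sigma> :: "'g \<Rightarrow> 'm \<Rightarrow> 'm" +
  fixes x :: 'm and Q :: "('g set, 'q::locally_convex_space) mfd"
  assumes point: "x \<in> mcarrier M"
    and Q_manifold: "Cr_manifold \<infinity> Q"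
    and Q_carrier: "mcarrier Q = lcosets (stabilizer G \<sigma> x)"
    and submersion: "smooth_submersion MG Q (\<lambda>g. g <# stabilizer G \<sigma> x)"
begin

lemma M_atlas: "Cr_atlas 1 (mtop M) (charts M)"
  using C1_manifold by (simp add: Cr_manifold_def)

lemma Q_atlas: "Cr_atlas 1 (mtop Q) (charts Q)"
  using Q_manifold Cr_atlas_le[of \<infinity>] by (auto simp: Cr_manifold_def)

text \<open>The common source of the tangent maps of \<open>g \<mapsto> gy\<close> and
  \<open>y \<mapsto> gy\<close>, which arise by restricting \<open>D\<close> to one of the two
  factors.\<close>

lemma action_tangent:
  assumes g: "g \<in> carrier G" and y: "y \<in> mcarrier M"
    and U: "(U, \<phi>) \<in> charts MG" "g \<in> U" and Y: "(Y, \<theta>) \<in> charts M" "y \<in> Y"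
    and V: "(V, \<psi>) \<in> charts M" "\<sigma> g y \<in> V"
  obtains D where "\<And>u v. D (u + v) = D u + D v"
    and "\<And>c l. c 0 = (g, y) \<Longrightarrow> chart_velocity (U \<times> Y, map_prod \<phi> \<theta>) c l
      \<Longrightarrow> chart_velocity (V, \<psi>) (\<lambda>t. \<sigma> (fst (c t)) (snd (c t))) (D l)"
proof -
  note a = prod_manifold_chartI[OF atlas(2) M_atlas U(1) Y(1)]
  have p: "(g, y) \<in> mcarrier (prod_manifold 1 MG M)" using g y carrier_eq by simp
  show ?thesis
  proof (rule Cr_map_on_tangent[OF C1_action a prod_manifold_is_chart[OF a] V(1) Cr_atlas_chart[OF M_atlas V(1)] p])
    fix D :: "'e \<times> 'f \<Rightarrow> 'f" assume D: "\<And>u v. D (u + v) = D u + D v"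
      "\<And>c l. c 0 = (g, y) \<Longrightarrow> chart_velocity (U \<times> Y, map_prod \<phi> \<theta>) c l
        \<Longrightarrow> chart_velocity (V, \<psi>) ((\<lambda>(g, y). \<sigma> g y) \<circ> c) (D l)"
    show thesis by (rule that[of D]) (use D in \<open>simp_all add: comp_def case_prod_unfold\<close>)
  qed (use U(2) Y(2) V(2) in simp_all)
qed

lemma orbit_map_tangent:
  assumes g: "g \<in> carrier G" and y: "y \<in> mcarrier M"
    and U: "(U, \<phi>) \<in> charts MG" "g \<in> U" and V: "(V, \<psi>) \<in> charts M" "\<sigma> g y \<in> V"
  obtains D where "\<And>u v. D (u + v) = D u + D v"
    and "\<And>c l. c 0 = g \<Longrightarrow> chart_velocity (U, \<phi>) c l \<Longrightarrow> chart_velocity (V, \<psi>) (\<lambda>t. \<sigma> (c t) y) (D l)"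
proof -
  obtain Y \<theta> where Y: "(Y, \<theta>) \<in> charts M" "y \<in> Y" using Cr_atlas_cover[OF M_atlas y] .
  obtain D where D: "\<And>u v. D (u + v) = D u + D v"
    "\<And>c l. c 0 = (g, y) \<Longrightarrow> chart_velocity (U \<times> Y, map_prod \<phi> \<theta>) c l
      \<Longrightarrow> chart_velocity (V, \<psi>) (\<lambda>t. \<sigma> (fst (c t)) (snd (c t))) (D l)"
    using action_tangent[OF g y U Y V] by blast
  show ?thesis
  proof (rule that[of "\<lambda>l. D (l, 0)"])
    show "D (u + v, 0) = D (u, 0) + D (v, 0)" for u v
      using D(1)[of "(u, 0)" "(v, 0)"] by simp
    show "chart_velocity (V, \<psi>) (\<lambda>t. \<sigma> (c t) y) (D (l, 0))" if "c 0 = g" "chart_velocity (U, \<phi>) c l" for c l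
      using D(2)[OF _ chart_velocity_Pair(1)[OF that(2) Y(2)]] that(1) by simp
  qed
qed

lemma translation_tangent:
  assumes g: "g \<in> carrier G" and y: "y \<in> mcarrier M"
    and Y: "(Y, \<theta>) \<in> charts M" "y \<in> Y" and V: "(V, \<psi>) \<in> charts M" "\<sigma> g y \<in> V"
  obtains D where "\<And>u v. D (u + v) = D u + D v"
    and "\<And>c l. c 0 = y \<Longrightarrow> chart_velocity (Y, \<theta>) c l \<Longrightarrow> chart_velocity (V, \<psi>) (\<lambda>t. \<sigma> g (c t)) (D l)"
proof -
  obtain U \<phi> where U: "(U, \<phi>) \<in> charts MG" "g \<in> U" using Cr_atlas_cover[OF atlas(1)] g carrier_eq by metis
  obtain D where D: "\<And>u v. D (u + v) = D u + D v"
    "\<And>c l. c 0 = (g, y) \<Longrightarrow> chart_velocity (U \<times> Y, map_prod \<phi> \<theta>) c l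
      \<Longrightarrow> chart_velocity (V, \<psi>) (\<lambda>t. \<sigma> (fst (c t)) (snd (c t))) (D l)"
    using action_tangent[OF g y U Y V] by blast
  show ?thesis
  proof (rule that[of "\<lambda>l. D (0, l)"])
    show "D (0, u + v) = D (0, u) + D (0, v)" for u v
      using D(1)[of "(0, u)" "(0, v)"] by simp
    show "chart_velocity (V, \<psi>) (\<lambda>t. \<sigma> g (c t)) (D (0, l))" if "c 0 = y" "chart_velocity (Y, \<theta>) c l" for c l
      using D(2)[OF _ chart_velocity_Pair(2)[OF that(2) U(2)]] that(1) by simp
  qed
qed

lemma orbit_curve_C1:
  assumes "C1_curve_at MG c t"
  shows "C1_curve_at M (\<lambda>s. \<sigma> (c s) x) t"
  using C1_curve_at_compose[OF C1_action C1_curve_at_Pair_const[OF assms point atlas(2) M_atlas] prod_manifold_is_chart M_atlas]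
  by (simp add: comp_def)

lemma coset_stabilizer_mult:
  assumes "g \<in> carrier G" "k \<in> stabilizer G \<sigma> x"
  shows "(g \<otimes> k) <# stabilizer G \<sigma> x = g <# stabilizer G \<sigma> x"
proof -
  have H: "subgroup (stabilizer G \<sigma> x) G" by (rule stabilizer_subgroup[OF point])
  have k: "k \<in> carrier G" using assms(2) by (simp add: stabilizer_def)
  have "(g \<otimes> k) <# stabilizer G \<sigma> x = g <# (k <# stabilizer G \<sigma> x)"
    using lcos_m_assoc[OF subgroup.subset[OF H] assms(1) k] by simp
  also have "k <# stabilizer G \<sigma> x = stabilizer G \<sigma> x"
    by (rule coset_join3[OF k H assms(2)])
  finally show ?thesis .
qed

text \<open>All elements of the coset move \<open>x\<close> to the same point, and the coset
  contains \<open>g\<close>; together this determines the definite description.\<close>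

lemma coset_orbit_map_coset:
  assumes g: "g \<in> carrier G"
  shows "coset_orbit_map \<sigma> x (g <# stabilizer G \<sigma> x) = \<sigma> g x"
proof -
  have H: "subgroup (stabilizer G \<sigma> x) G" by (rule stabilizer_subgroup[OF point])
  have eq: "\<sigma> k x = \<sigma> g x" if "k \<in> g <# stabilizer G \<sigma> x" for k
    using that composition_rule[OF point g] by (auto simp: l_coset_def stabilizer_def)
  have in_coset: "g \<in> g <# stabilizer G \<sigma> x"
    using subgroup.one_closed[OF H] g by (auto simp: l_coset_def intro!: bexI[of _ \<one>])
  show ?thesis
    unfolding coset_orbit_map_def
  proof (rule the_equality)
    show "\<forall>k\<in>g <# stabilizer G \<sigma> x. \<sigma> g x = \<sigma> k x" using eq by (intro ballI) (rule sym)
    fix y assume "\<forall>k\<in>g <# stabilizer G \<sigma> x. y = \<sigma> k x"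
    then show "y = \<sigma> g x" using in_coset by blast
  qed
qed

lemma lift_curve:
  assumes c: "Cr_map_on 1 (lcs_manifold 1) Q I c" and t0: "t0 \<in> I"
    and g: "g \<in> carrier G" "c t0 = g <# stabilizer G \<sigma> x"
  obtains T d where "open T" "t0 \<in> T" "T \<subseteq> I" "d t0 = g"
    "\<And>t. t \<in> T \<Longrightarrow> d t \<in> carrier G" "\<And>t. t \<in> T \<Longrightarrow> d t <# stabilizer G \<sigma> x = c t"
    "\<And>t. t \<in> T \<Longrightarrow> C1_curve_at MG d t"
proof -
  define q where "q = (\<lambda>g. g <# stabilizer G \<sigma> x)"
  have "g \<in> mcarrier MG" using g(1) carrier_eq by simp
  then have "\<exists>(U, \<phi>)\<in>charts MG. \<exists>(V, \<psi>)\<in>charts Q. g \<in> U \<and> q ` U \<subseteq> V \<and>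
      (\<exists>\<pi>. linear \<pi> \<and> continuous_on UNIV \<pi> \<and>
        (\<exists>s. linear s \<and> continuous_on UNIV s \<and> \<pi> \<circ> s = id) \<and>
        (\<forall>z\<in>\<phi> ` U. (\<psi> \<circ> q \<circ> inv_into U \<phi>) z = \<pi> z))"
    using submersion unfolding smooth_submersion_def q_def by (elim conjE) (rule bspec)
  then obtain U \<phi> V \<psi> \<pi> s where U: "(U, \<phi>) \<in> charts MG" "g \<in> U" and V: "(V, \<psi>) \<in> charts Q"
    and qU: "q ` U \<subseteq> V" and \<pi>: "linear \<pi>" and s: "linear s" "continuous_on UNIV s" "\<pi> \<circ> s = id"
    and rep: "\<forall>z\<in>\<phi> ` U. (\<psi> \<circ> q \<circ> inv_into U \<phi>) z = \<pi> z"
    unfolding Bex_def split_paired_Ex prod.case by (elim exE conjE) (rule that)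
  note chU = Cr_atlas_chart[OF atlas(1) U(1)] and chV = Cr_atlas_chart[OF Q_atlas V]
  have inj: "inj_on \<phi> U" "inj_on \<psi> V" using is_chartD(2) chU chV by blast+
  have U_carrier: "U \<subseteq> carrier G" using openin_subset[OF is_chartD(1)[OF chU]] carrier_eq by simp
  have ct0: "c t0 \<in> V" using g(2) qU U(2) by (auto simp: q_def)
  define S where "S = {t \<in> I. c t \<in> V}"
  have S: "open S" "Cr_on 1 S (\<psi> \<circ> c)"
    using Cr_map_on_curve_rep[OF c V chV] by (simp_all add: S_def)
  \<comment> \<open>The constant is chosen so that \<open>\<kappa> t0 = \<phi> g\<close>: the linear
    right inverse \<open>s\<close> alone would give a lift that need not pass through the prescribed
    \<open>g\<close>.\<close>
  define \<kappa> where "\<kappa> = (\<lambda>z. (\<phi> g - s (\<psi> (c t0))) + s z) \<circ> (\<psi> \<circ> c)"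
  have \<kappa>: "Cr_on 1 S \<kappa>"
    unfolding \<kappa>_def by (rule C1_on_compose[OF S(2) C1_on_affine[OF s(1,2), of UNIV]]) auto
  define T where "T = S \<inter> \<kappa> -` (\<phi> ` U)"
  define d where "d = (\<lambda>t. inv_into U \<phi> (\<kappa> t))"
  have "open (\<phi> ` U)" using chU by (simp add: is_chart_def)
  then have T: "open T"
    unfolding T_def by (rule continuous_open_preimage[OF Cr_on_continuous[OF \<kappa>] S(1)])
  have \<kappa>0: "\<kappa> t0 = \<phi> g" by (simp add: \<kappa>_def)
  have d: "d t \<in> U" "\<phi> (d t) = \<kappa> t" if "t \<in> T" for t
    using that by (auto simp: T_def d_def intro: inv_into_into f_inv_into_f)
  \<comment> \<open>In coordinates \<open>q\<close> is \<open>\<pi>\<close>, and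
    \<open>\<pi> \<circ> s = id\<close> gives \<open>\<pi> (\<kappa> t) = \<psi> (c t)\<close>, the
    constants cancelling because \<open>\<pi> (\<phi> g) = \<psi> (c t0)\<close>. Injectivity of
    \<open>\<psi>\<close> applies since \<open>q\<close> maps all of \<open>U\<close> into
    \<open>V\<close>.\<close>
  have qd: "q (d t) = c t" if t: "t \<in> T" for t
  proof (rule inj_onD[OF inj(2)])
    have \<pi>s: "\<pi> (s z) = z" for z using s(3) by (metis comp_apply id_apply)
    have "\<psi> (q (d t)) = \<pi> (\<kappa> t)" using bspec[OF rep, of "\<kappa> t"] t by (simp add: T_def d_def)
    also have "\<dots> = \<pi> (\<phi> g) - \<psi> (c t0) + \<psi> (c t)"
      by (simp add: \<kappa>_def linear_add[OF \<pi>] linear_diff[OF \<pi>] \<pi>s)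
    also have "\<pi> (\<phi> g) = \<psi> (c t0)" using bspec[OF rep, of "\<phi> g"] U(2) inj(1) g(2) by (simp add: q_def)
    finally show "\<psi> (q (d t)) = \<psi> (c t)" by simp
    show "q (d t) \<in> V" using qU d(1)[OF t] by blast
    show "c t \<in> V" using t by (simp add: T_def S_def)
  qed
  have "Cr_on 1 T (\<phi> \<circ> d)"
    by (rule Cr_on_cong[OF T _ Cr_on_mono[OF \<kappa>]]) (auto simp: d T_def)
  then have C1: "C1_curve_at MG d t" if "t \<in> T" for t
    unfolding C1_curve_at_def using U(1) T that d(1)
    by (intro bexI[of _ "(U, \<phi>)"]) (auto intro!: exI[of _ T])
  show ?thesis
  proof (rule that[of T d])
    show "t0 \<in> T" using t0 ct0 \<kappa>0 U(2) by (simp add: T_def S_def)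
    show "T \<subseteq> I" by (auto simp: T_def S_def)
    show "d t0 = g" using \<kappa>0 inj(1) U(2) by (simp add: d_def)
    show "d t \<in> carrier G" if "t \<in> T" for t using U_carrier d(1)[OF that] by blast
    show "d t <# stabilizer G \<sigma> x = c t" if "t \<in> T" for t using qd[OF that] by (simp add: q_def)
  qed (use T C1 in simp_all)
qed

text \<open>Near each time the curve lifts to \<open>G\<close>, and there its image is the orbit
  curve of the lift. The lift starts at any representative of the coset \<open>c t\<close>, not only
  at time 0, because a C^1 curve is required to be C^1 on an interval.\<close>

lemma coset_orbit_curve_C1:
  assumes c: "C1_curve Q (g <# stabilizer G \<sigma> x) c" and g: "g \<in> carrier G"
  shows "C1_curve M (\<sigma> g x) (coset_orbit_map \<sigma> x \<circ> c)"
proof -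
  from c obtain e where e: "e > 0" "c 0 = g <# stabilizer G \<sigma> x" "Cr_map_on 1 (lcs_manifold 1) Q {-e<..<e} c"
    by (auto simp: C1_curve_def)
  have "C1_curve_at M (coset_orbit_map \<sigma> x \<circ> c) t" if t: "t \<in> {-e<..<e}" for t
  proof -
    have "c t \<in> mcarrier Q" using e(3) t by (auto simp: Cr_map_on_def continuous_map_def Pi_iff)
    then obtain h where h: "h \<in> carrier G" "c t = h <# stabilizer G \<sigma> x"
      unfolding Q_carrier by (auto simp: LCOSETS_def)
    obtain T d where T: "open T" "t \<in> T" and d: "\<And>s. s \<in> T \<Longrightarrow> d s \<in> carrier G"
      "\<And>s. s \<in> T \<Longrightarrow> d s <# stabilizer G \<sigma> x = c s" "\<And>s. s \<in> T \<Longrightarrow> C1_curve_at MG d s"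
      using lift_curve[OF e(3) t h] by metis
    show ?thesis
      by (rule C1_curve_at_cong[OF orbit_curve_C1[OF d(3)[OF T(2)]] T])
        (metis d(1,2) coset_orbit_map_coset comp_apply)
  qed
  then have "C1_curve M ((coset_orbit_map \<sigma> x \<circ> c) 0) (coset_orbit_map \<sigma> x \<circ> c)"
    using e(1) by (intro C1_curveI[OF M_atlas, of "{-e<..<e}"]) (simp_all del: o_apply)
  then show ?thesis using e(2) coset_orbit_map_coset[OF g] by simp
qed

text \<open>
  \<open>\<eta> (s + t) = \<sigma> (\<gamma> s) (\<eta> t)\<close> transports the vanishing velocity at \<open>0\<close> to all times, so \<open>\<eta>\<close> is
  constant as long as it stays in the chart.
\<close>

lemma one_parameter_subgroup_in_stabilizer:
  assumes \<gamma>: "\<gamma> 0 = \<one>" "\<And>s t. \<gamma> (s + t) = \<gamma> s \<otimes> \<gamma> t" "\<And>t. \<gamma> t \<in> carrier G"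
    and Y: "(Y, \<theta>) \<in> charts M" "x \<in> Y" and vel: "chart_velocity (Y, \<theta>) (\<lambda>t. \<sigma> (\<gamma> t) x) 0"
  shows "\<forall>\<^sub>F t in nhds 0. \<gamma> t \<in> stabilizer G \<sigma> x"
proof -
  define \<eta> where "\<eta> = (\<lambda>t. \<sigma> (\<gamma> t) x)"
  have \<eta>0: "\<eta> 0 = x" using orbit_sym_aux[OF one_closed point] id_eq_one point
    by (metis \<eta>_def \<gamma>(1) restrict_apply')
  have \<eta>_add: "\<eta> (s + t) = \<sigma> (\<gamma> s) (\<eta> t)" for s t
    using composition_rule[OF point \<gamma>(3) \<gamma>(3)] by (simp add: \<eta>_def \<gamma>(2))
  have "\<forall>\<^sub>F t in nhds 0. \<eta> t \<in> Y" using vel by (simp add: chart_velocity_def \<eta>_def)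
  then obtain e where e: "e > 0" "\<And>t. \<bar>t\<bar> < e \<Longrightarrow> \<eta> t \<in> Y"
    by (auto simp: eventually_nhds_metric dist_real_def)
  have deriv: "(dir_quot (\<theta> \<circ> \<eta>) s 1 \<longlongrightarrow> 0) (at 0)" if s: "\<bar>s\<bar> < e" for s
  proof -
    have "\<eta> (s + 0) \<in> Y" using e(2)[OF s] by simp
    then have Y': "\<sigma> (\<gamma> s) x \<in> Y" by (simp only: \<eta>_add \<eta>0)
    obtain D where D: "\<And>u v. D (u + v) = D u + D v"
      "\<And>c l. c 0 = x \<Longrightarrow> chart_velocity (Y, \<theta>) c l \<Longrightarrow> chart_velocity (Y, \<theta>) (\<lambda>t. \<sigma> (\<gamma> s) (c t)) (D l)"
      using translation_tangent[OF \<gamma>(3) point Y Y(1) Y'] by blast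
    \<comment> \<open>An additive map sends 0 to 0, so translation by \<open>\<gamma> s\<close>
      preserves the vanishing velocity. The translated curve is \<open>\<eta>\<close> with its time
      shifted by \<open>s\<close>.\<close>
    have "chart_velocity (Y, \<theta>) (\<lambda>t. \<sigma> (\<gamma> s) (\<eta> t)) 0"
      using D(2)[of \<eta> 0] \<eta>0 vel additive_diff(2)[of D, OF D(1)] by (simp add: \<eta>_def)
    then have "(dir_quot (\<theta> \<circ> (\<lambda>t. \<eta> (s + t))) 0 1 \<longlongrightarrow> 0) (at 0)"
      by (simp add: chart_velocity_def \<eta>_add)
    moreover have "dir_quot (\<theta> \<circ> (\<lambda>t. \<eta> (s + t))) 0 1 = dir_quot (\<theta> \<circ> \<eta>) s 1"
      by (simp add: dir_quot_def fun_eq_iff)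
    ultimately show ?thesis by simp
  qed
  have "\<eta> t = x" if t: "\<bar>t\<bar> < e" for t
  proof -
    have "(\<theta> \<circ> \<eta>) t = (\<theta> \<circ> \<eta>) 0"
    proof (cases t "0::real" rule: linorder_cases)
      case less
      then show ?thesis using constant_if_deriv_zero[of t 0 "\<theta> \<circ> \<eta>", OF deriv] t by force
    next
      case greater
      then show ?thesis using constant_if_deriv_zero[of 0 t "\<theta> \<circ> \<eta>", OF deriv] t by force
    qed simp
    then show ?thesis
      using inj_onD[OF is_chartD(2)[OF Cr_atlas_chart[OF M_atlas Y(1)]], of "\<eta> t" x] e(2)[OF t] Y(2) \<eta>0 by simp
  qed
  then have "\<forall>\<^sub>F t in nhds 0. \<eta> t = x"
    using e(1) by (auto simp: eventually_nhds_metric dist_real_def)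
  then show ?thesis
    by eventually_elim (use \<gamma>(3) in \<open>simp add: stabilizer_def \<eta>_def\<close>)
qed

text \<open>Two additive maps on the coordinates of L(G) are compared: \<open>B\<close> for the
  orbit map at the identity, and \<open>K\<close> for \<open>h \<mapsto> ghG\<^sub>x\<close>, the
  composite of left translation \<open>L\<close> and projection \<open>P\<close>. The content is
  that \<open>B\<close> annihilating \<open>u\<^sub>1 - u\<^sub>2\<close> forces \<open>K\<close> to
  do so; the given curves only identify the values of \<open>B\<close> and \<open>K\<close> at
  \<open>u\<^sub>1\<close> and \<open>u\<^sub>2\<close>.\<close>

lemma coset_velocity_eqI:
  assumes exp: "has_exponential G MG" and g: "g \<in> carrier G"
    and U: "(U, \<phi>) \<in> charts MG" "\<one> \<in> U"
    and e0: "e\<^sub>1 0 = \<one>" "e\<^sub>2 0 = \<one>"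
    and u: "chart_velocity (U, \<phi>) e\<^sub>1 u\<^sub>1" "chart_velocity (U, \<phi>) e\<^sub>2 u\<^sub>2"
    and Y: "(Y, \<theta>) \<in> charts M" "x \<in> Y"
    and orbit: "chart_velocity (Y, \<theta>) (\<lambda>t. \<sigma> (e\<^sub>1 t) x) w" "chart_velocity (Y, \<theta>) (\<lambda>t. \<sigma> (e\<^sub>2 t) x) w"
    and V: "(V, \<psi>) \<in> charts Q" "g <# stabilizer G \<sigma> x \<in> V"
    and coset: "chart_velocity (V, \<psi>) (\<lambda>t. (g \<otimes> e\<^sub>1 t) <# stabilizer G \<sigma> x) w\<^sub>1"
      "chart_velocity (V, \<psi>) (\<lambda>t. (g \<otimes> e\<^sub>2 t) <# stabilizer G \<sigma> x) w\<^sub>2"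
  shows "w\<^sub>1 = w\<^sub>2"
proof -
  obtain \<gamma> where \<gamma>: "\<gamma> 0 = \<one>" "\<And>s t. \<gamma> (s + t) = \<gamma> s \<otimes> \<gamma> t" "\<And>t. \<gamma> t \<in> carrier G"
      "chart_velocity (U, \<phi>) \<gamma> (u\<^sub>1 - u\<^sub>2)"
    using one_parameter_group[OF exp U, of "u\<^sub>1 - u\<^sub>2"] by metis
  have one_x: "\<sigma> \<one> x = x" using id_eq_one point by (metis restrict_apply')
  then have Y': "\<sigma> \<one> x \<in> Y" using Y(2) by simp
  obtain B where B: "\<And>u v. B (u + v) = B u + B v"
    "\<And>c l. c 0 = \<one> \<Longrightarrow> chart_velocity (U, \<phi>) c l \<Longrightarrow> chart_velocity (Y, \<theta>) (\<lambda>t. \<sigma> (c t) x) (B l)"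
    using orbit_map_tangent[OF one_closed point U Y(1) Y'] by blast
  have "B u\<^sub>1 = w" "B u\<^sub>2 = w"
    using chart_velocity_inj B(2)[of e\<^sub>1] B(2)[of e\<^sub>2] e0 u orbit by metis+
  then have "chart_velocity (Y, \<theta>) (\<lambda>t. \<sigma> (\<gamma> t) x) 0"
    using B(2)[of \<gamma>, OF \<gamma>(1,4)] additive_diff(1)[of B, OF B(1)] by simp
  then have stab: "\<forall>\<^sub>F t in nhds 0. \<gamma> t \<in> stabilizer G \<sigma> x"
    by (rule one_parameter_subgroup_in_stabilizer[OF \<gamma>(1-3) Y])
  obtain X \<xi> where X: "(X, \<xi>) \<in> charts MG" "g \<in> X" using Cr_atlas_cover[OF atlas(1)] g carrier_eq by metis
  have X1: "g \<otimes> \<one> \<in> X" using X(2) g by simp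
  obtain L where L: "\<And>u v. L (u + v) = L u + L v"
    "\<And>c l. c 0 = \<one> \<Longrightarrow> chart_velocity (U, \<phi>) c l \<Longrightarrow> chart_velocity (X, \<xi>) (\<lambda>t. g \<otimes> c t) (L l)"
    using left_mult_tangent[OF g U X(1) X1] by blast
  have q: "Cr_map_on 1 MG Q (mcarrier MG) (\<lambda>g. g <# stabilizer G \<sigma> x)"
    using submersion by (auto simp: smooth_submersion_def intro: Cr_map_on_le)
  have g': "g \<in> mcarrier MG" using g carrier_eq by simp
  obtain P where P: "\<And>u v. P (u + v) = P u + P v"
    "\<And>c l. c 0 = g \<Longrightarrow> chart_velocity (X, \<xi>) c l \<Longrightarrow> chart_velocity (V, \<psi>) ((\<lambda>g. g <# stabilizer G \<sigma> x) \<circ> c) (P l)"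
    using Cr_map_on_tangent[OF q X(1) Cr_atlas_chart[OF atlas(1) X(1)] V(1) Cr_atlas_chart[OF Q_atlas V(1)] g' X(2) V(2)] by blast
  define K where "K = (\<lambda>u. P (L u))"
  have K_add: "K (u + v) = K u + K v" for u v by (simp add: K_def L(1) P(1))
  have K: "chart_velocity (V, \<psi>) (\<lambda>t. (g \<otimes> c t) <# stabilizer G \<sigma> x) (K l)"
    if "c 0 = \<one>" "chart_velocity (U, \<phi>) c l" for c l
    using P(2)[of "\<lambda>t. g \<otimes> c t", OF _ L(2)[of c, OF that]] that(1) g by (simp add: K_def comp_def)
  \<comment> \<open>Velocities depend only on the germ at 0, so it suffices that
    \<open>\<gamma>\<close> lies in the stabilizer for small times.\<close>
  have "\<forall>\<^sub>F t in nhds 0. (g \<otimes> \<gamma> t) <# stabilizer G \<sigma> x = g <# stabilizer G \<sigma> x"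
    using stab by eventually_elim (rule coset_stabilizer_mult[OF g])
  then have "chart_velocity (V, \<psi>) (\<lambda>_. g <# stabilizer G \<sigma> x) (K (u\<^sub>1 - u\<^sub>2))"
    by (rule chart_velocity_cong) (rule K[of \<gamma>, OF \<gamma>(1,4)])
  then have "K (u\<^sub>1 - u\<^sub>2) = 0" using chart_velocity_const[OF V(2)] by (rule chart_velocity_inj)
  moreover have "K u\<^sub>1 = w\<^sub>1" "K u\<^sub>2 = w\<^sub>2"
    using chart_velocity_inj K[of e\<^sub>1] K[of e\<^sub>2] e0 u coset by metis+
  ultimately show ?thesis using additive_diff(1)[of K, OF K_add, of u\<^sub>1 u\<^sub>2] by simp
qed

text \<open>Left translation by \<open>inv g\<close> moves the lift to the identity, where
  one-parameter groups start. The last two clauses record what this does to the cosets and to the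
  orbit; they hold only near 0, where the lift exists.\<close>

lemma lift_curve_at_one:
  assumes c: "C1_curve Q (g <# stabilizer G \<sigma> x) c" and g: "g \<in> carrier G"
    and U: "(U, \<phi>) \<in> charts MG" "\<one> \<in> U"
  obtains e u where "e 0 = \<one>" "chart_velocity (U, \<phi>) e u"
    "\<forall>\<^sub>F t in nhds 0. c t = (g \<otimes> e t) <# stabilizer G \<sigma> x"
    "\<forall>\<^sub>F t in nhds 0. \<sigma> (inv g) (coset_orbit_map \<sigma> x (c t)) = \<sigma> (e t) x"
proof -
  from c obtain r where r: "r > 0" "c 0 = g <# stabilizer G \<sigma> x" "Cr_map_on 1 (lcs_manifold 1) Q {-r<..<r} c"
    by (auto simp: C1_curve_def)
  have "0 \<in> {-r<..<r}" using r(1) by simp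
  then obtain T d where T: "open T" "0 \<in> T" and d: "d 0 = g" "\<And>t. t \<in> T \<Longrightarrow> d t \<in> carrier G"
      "\<And>t. t \<in> T \<Longrightarrow> d t <# stabilizer G \<sigma> x = c t" "\<And>t. t \<in> T \<Longrightarrow> C1_curve_at MG d t"
    using lift_curve[OF r(3) _ g r(2)] by metis
  have "C1_curve MG g d" using C1_curveI[OF atlas(2) T d(4)] d(1) by simp
  moreover obtain X \<xi> where X: "(X, \<xi>) \<in> charts MG" "g \<in> X" using Cr_atlas_cover[OF atlas(1)] g carrier_eq by metis
  ultimately obtain l where l: "chart_velocity (X, \<xi>) d l"
    using C1_curve_velocity[OF _ X(1) Cr_atlas_chart[OF atlas(1) X(1)] X(2)] by blast
  have U': "inv g \<otimes> g \<in> U" using g U(2) by simp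
  obtain L where "\<And>u v. L (u + v) = L u + L v" and L: "\<And>c l. c 0 = g \<Longrightarrow> chart_velocity (X, \<xi>) c l \<Longrightarrow> chart_velocity (U, \<phi>) (\<lambda>t. inv g \<otimes> c t) (L l)"
    using left_mult_tangent[OF inv_closed[OF g] X U(1) U'] by blast
  from L[of d, OF d(1) l] have vel: "chart_velocity (U, \<phi>) (\<lambda>t. inv g \<otimes> d t) (L l)" .
  have ev: "\<forall>\<^sub>F t in nhds 0. t \<in> T" using T by (rule eventually_nhds_in_open)
  show ?thesis
  proof (rule that[OF _ vel])
    show "inv g \<otimes> d 0 = \<one>" using d(1) g by simp
    show "\<forall>\<^sub>F t in nhds 0. c t = (g \<otimes> (inv g \<otimes> d t)) <# stabilizer G \<sigma> x"
      using ev by eventually_elim (use d(2,3) g in \<open>simp flip: m_assoc\<close>)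
    show "\<forall>\<^sub>F t in nhds 0. \<sigma> (inv g) (coset_orbit_map \<sigma> x (c t)) = \<sigma> (inv g \<otimes> d t) x"
      using ev
    proof eventually_elim
      case (elim t)
      then show ?case
        using composition_rule[OF point inv_closed[OF g] d(2)[OF elim]] coset_orbit_map_coset[OF d(2)[OF elim]] d(3)[OF elim]
        by simp
    qed
  qed
qed

text \<open>The hypothesis concerns velocities at \<open>gx\<close>, whereas the normalised lifts
  give orbit curves through \<open>x\<close>. Translation by \<open>inv g\<close> sends the common
  velocity \<open>w\<close> of both curves to the common value \<open>D w\<close>.\<close>

lemma tangent_rel_if_orbit_tangent_rel:
  assumes exp: "has_exponential G MG" and g: "g \<in> carrier G"
    and c: "C1_curve Q (g <# stabilizer G \<sigma> x) c\<^sub>1" "C1_curve Q (g <# stabilizer G \<sigma> x) c\<^sub>2"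
    and rel: "(coset_orbit_map \<sigma> x \<circ> c\<^sub>1, coset_orbit_map \<sigma> x \<circ> c\<^sub>2) \<in> tangent_rel M (\<sigma> g x)"
  shows "(c\<^sub>1, c\<^sub>2) \<in> tangent_rel Q (g <# stabilizer G \<sigma> x)"
  unfolding tangent_rel_iff
proof (intro conjI c allI impI)
  fix V \<psi> assume V: "(V, \<psi>) \<in> charts Q" "g <# stabilizer G \<sigma> x \<in> V"
  let ?b = "coset_orbit_map \<sigma> x"
  obtain U \<phi> where U: "(U, \<phi>) \<in> charts MG" "\<one> \<in> U"
    using Cr_atlas_cover[OF atlas(1)] one_closed carrier_eq by metis
  obtain Y \<theta> where Y: "(Y, \<theta>) \<in> charts M" "x \<in> Y" using Cr_atlas_cover[OF M_atlas point] .
  have gx: "\<sigma> g x \<in> mcarrier M" using element_image[OF g point] by simp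
  obtain Z \<zeta> where Z: "(Z, \<zeta>) \<in> charts M" "\<sigma> g x \<in> Z" using Cr_atlas_cover[OF M_atlas gx] .
  define w where "w = dir_deriv (\<zeta> \<circ> (?b \<circ> c\<^sub>1)) 0 1"
  have w: "chart_velocity (Z, \<zeta>) (?b \<circ> c\<^sub>1) w" "chart_velocity (Z, \<zeta>) (?b \<circ> c\<^sub>2) w"
    using C1_curve_velocity[OF _ Z(1) Cr_atlas_chart[OF M_atlas Z(1)] Z(2)] rel Z
    unfolding tangent_rel_iff w_def by metis+
  have inv_back: "\<sigma> (inv g) (\<sigma> g x) = x" by (rule orbit_sym_aux[OF g point refl])
  then have Y': "\<sigma> (inv g) (\<sigma> g x) \<in> Y" using Y(2) by simp
  obtain D where "\<And>u v. D (u + v) = D u + D v" and D: "\<And>c l. c 0 = \<sigma> g x \<Longrightarrow> chart_velocity (Z, \<zeta>) c l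
      \<Longrightarrow> chart_velocity (Y, \<theta>) (\<lambda>t. \<sigma> (inv g) (c t)) (D l)"
    using translation_tangent[OF inv_closed[OF g] gx Z Y(1) Y'] by blast
  have c0: "(?b \<circ> c\<^sub>1) 0 = \<sigma> g x" "(?b \<circ> c\<^sub>2) 0 = \<sigma> g x"
    using c coset_orbit_map_coset[OF g] by (simp_all add: C1_curve_def)
  obtain e\<^sub>1 u\<^sub>1 where e1: "e\<^sub>1 0 = \<one>" "chart_velocity (U, \<phi>) e\<^sub>1 u\<^sub>1"
    "\<forall>\<^sub>F t in nhds 0. c\<^sub>1 t = (g \<otimes> e\<^sub>1 t) <# stabilizer G \<sigma> x"
    "\<forall>\<^sub>F t in nhds 0. \<sigma> (inv g) (?b (c\<^sub>1 t)) = \<sigma> (e\<^sub>1 t) x"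
    by (rule lift_curve_at_one[OF c(1) g U])
  obtain e\<^sub>2 u\<^sub>2 where e2: "e\<^sub>2 0 = \<one>" "chart_velocity (U, \<phi>) e\<^sub>2 u\<^sub>2"
    "\<forall>\<^sub>F t in nhds 0. c\<^sub>2 t = (g \<otimes> e\<^sub>2 t) <# stabilizer G \<sigma> x"
    "\<forall>\<^sub>F t in nhds 0. \<sigma> (inv g) (?b (c\<^sub>2 t)) = \<sigma> (e\<^sub>2 t) x"
    by (rule lift_curve_at_one[OF c(2) g U])
  have orbit: "chart_velocity (Y, \<theta>) (\<lambda>t. \<sigma> (e\<^sub>1 t) x) (D w)" "chart_velocity (Y, \<theta>) (\<lambda>t. \<sigma> (e\<^sub>2 t) x) (D w)"
    using chart_velocity_cong[OF e1(4)] chart_velocity_cong[OF e2(4)]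
      D[of "?b \<circ> c\<^sub>1", OF c0(1) w(1)] D[of "?b \<circ> c\<^sub>2", OF c0(2) w(2)] by simp_all
  note vel = C1_curve_velocity[OF _ V(1) Cr_atlas_chart[OF Q_atlas V(1)] V(2)]
  show "dir_deriv (\<psi> \<circ> c\<^sub>1) 0 1 = dir_deriv (\<psi> \<circ> c\<^sub>2) 0 1"
    by (rule coset_velocity_eqI[OF exp g U e1(1) e2(1) e1(2) e2(2) Y orbit V
        chart_velocity_cong[OF e1(3) vel[OF c(1)]] chart_velocity_cong[OF e2(3) vel[OF c(2)]]])
qed

text \<open>\<open>tangent_map\<close> is a union over all representatives. One representative of
  \<open>v\<^sub>1\<close> is therefore followed into the union for \<open>v\<^sub>2\<close>, where
  it is met by some representative of \<open>v\<^sub>2\<close>; the argument runs with that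
  pair.\<close>

lemma inj_on_tangent_map:
  assumes exp: "has_exponential G MG" and g: "g \<in> carrier G"
  shows "inj_on (tangent_map M (coset_orbit_map \<sigma> x)) (tangent_space Q (g <# stabilizer G \<sigma> x))"
proof (rule inj_onI)
  let ?p = "g <# stabilizer G \<sigma> x" and ?b = "coset_orbit_map \<sigma> x"
  fix v\<^sub>1 v\<^sub>2 assume v: "v\<^sub>1 \<in> tangent_space Q ?p" "v\<^sub>2 \<in> tangent_space Q ?p"
    and eq: "tangent_map M ?b v\<^sub>1 = tangent_map M ?b v\<^sub>2"
  note equiv = equiv_tangent_rel[of Q ?p]
  from v obtain c\<^sub>1 where c1: "v\<^sub>1 = tangent_rel Q ?p `` {c\<^sub>1}" "C1_curve Q ?p c\<^sub>1"
    unfolding tangent_space_def by (auto elim!: quotientE)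
  have c1_v1: "c\<^sub>1 \<in> v\<^sub>1" using c1 by (simp add: tangent_rel_iff)
  have start: "(?b \<circ> c) 0 = \<sigma> g x" if "C1_curve Q ?p c" for c
    using coset_orbit_curve_C1[OF that g] by (simp add: C1_curve_def)
  \<comment> \<open>Reflexivity of the tangent relation holds only on C^1 curves, so the image curve
    must be known to be C^1.\<close>
  have "?b \<circ> c\<^sub>1 \<in> velocity M (?b \<circ> c\<^sub>1)"
    using coset_orbit_curve_C1[OF c1(2) g] start[OF c1(2)] by (simp add: velocity_def tangent_rel_iff)
  then have "?b \<circ> c\<^sub>1 \<in> tangent_map M ?b v\<^sub>2"
    unfolding eq[symmetric] unfolding tangent_map_def by (rule UN_I[OF c1_v1])
  then obtain c\<^sub>2 where c2: "c\<^sub>2 \<in> v\<^sub>2" "?b \<circ> c\<^sub>1 \<in> velocity M (?b \<circ> c\<^sub>2)"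
    unfolding tangent_map_def by blast
  have C2: "C1_curve Q ?p c\<^sub>2"
    using v(2) c2(1) unfolding tangent_space_def by (auto elim!: quotientE simp: tangent_rel_iff)
  have "(?b \<circ> c\<^sub>2, ?b \<circ> c\<^sub>1) \<in> tangent_rel M (\<sigma> g x)"
    using c2(2) start[OF C2] by (simp add: velocity_def)
  then have "(c\<^sub>2, c\<^sub>1) \<in> tangent_rel Q ?p"
    by (rule tangent_rel_if_orbit_tangent_rel[OF exp g C2 c1(2)])
  then show "v\<^sub>1 = v\<^sub>2"
    using quotient_eq_iff[OF equiv v(2)[unfolded tangent_space_def] v(1)[unfolded tangent_space_def] c2(1) c1_v1] by simp
qed

end

theorem theoremI:
  fixes G :: "('g, 'b) monoid_scheme"
    and MG :: "('g, 'e::locally_convex_space) mfd"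
    and M :: "('m, 'f::locally_convex_space) mfd"
    and \<sigma> :: "'g \<Rightarrow> 'm \<Rightarrow> 'm"
    and x :: 'm
    and Q :: "('g set, 'q::locally_convex_space) mfd"
  assumes "lie_group G MG"
    and "has_exponential G MG"
    and "C1_action G MG M \<sigma>"
    and "x \<in> mcarrier M"
    and "Cr_manifold \<infinity> Q"
    and "mcarrier Q = lcosets\<^bsub>G\<^esub> (stabilizer G \<sigma> x)"
    and "smooth_submersion MG Q (\<lambda>g. g <#\<^bsub>G\<^esub> stabilizer G \<sigma> x)"
  shows "\<forall>g \<in> carrier G.
    inj_on (tangent_map M (coset_orbit_map \<sigma> x))
      (tangent_space Q (g <#\<^bsub>G\<^esub> stabilizer G \<sigma> x))"
proof -
  interpret lie_group G MG by fact
  interpret C1_action G MG M \<sigma> by fact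
  interpret smooth_homogeneous_space G MG M \<sigma> x Q
    using assms by unfold_locales
  show ?thesis using inj_on_tangent_map[OF assms(2)] by blast
qed

end
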